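(* Let $1<\alpha\le2$, $N\ge0$, $P>0$, $a(0),\dots,a(N)\in\mathbb C$, and let $$D_f^0=\left\{f:\int_{-\pi}^{\pi}f(\theta)\,d\theta=P\right\}$$ be a class of spectral densities of scalar harmonizable symmetric $\alpha$-stable sequences. Suppose that the spectral density $$f_0(\theta)=C\left|\sum_{j=0}^{N}c(j)e^{-ij\theta}\right|$$ (with a constant $C>0$ and $c(0),\dots,c(N)\in\mathbb C$) satisfies the minimality condition $\int_{-\pi}^{\pi}(f_0(\theta))^{-1/(\alpha-1)}d\theta<\infty$, the equations $$\int_{-\pi}^{\pi}e^{-ik\theta}\left[\sum_{j=0}^{N}a(j)e^{ij\theta}-\left((f_0(\theta))^{-1}\sum_{j=0}^{N}c(j)e^{-ij\theta}\right)^{<\frac1{\alpha-1}>}\right]d\theta=0,\quad k=0,1,\dots,N,$$ and the condition $f_0\in D_f^0$, i.e. $\int_{-\pi}^{\pi}f_0(\theta)d\theta=P$. Then $f_0$ is the least favorable spectral density in $D_f^0$ for the optimal linear estimation of the functional $A_N\xi=\sum_{j=0}^{N}a(j)\xi(j)$ from observations of $\xi(j)$, $j\in\mathbb Z\setminus\{0,1,\dots,N\}$, and the minimax-robust spectral characteristic of the optimal estimate of $A_N\xi$ is $$h(f_0)(\theta)=\sum_{j=0}^{N}a(j)e^{ij\theta}-\left((f_0(\theta))^{-1}\sum_{j=0}^{N}c(j)e^{-ij\theta}\right)^{<\frac1{\alpha-1}>}.$$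
   Context: For complex $z$ and $\beta>0$, $z^{<\beta>}=|z|^{\beta-1}\bar z$. A scalar harmonizable symmetric $\alpha$-stable sequence has the form $\xi(n)=\int_{-\pi}^{\pi}e^{in\theta}dZ(\theta)$, with $Z$ a complex symmetric $\alpha$-stable process with independent increments and finite spectral measure $\mu((s,t])=\|Z(t)-Z(s)\|_\alpha^\alpha$; here $d\mu=f\,d\theta$ with spectral density $f\ge0$, and $\left\|\int a\,dZ\right\|_\alpha^\alpha=\int|a|^\alpha f\,d\theta$ (where $\|\cdot\|_\alpha$ is the covariation norm). $L_N^\alpha(f)$ is the closed subspace of $L^\alpha(f\,d\theta)$ on $[-\pi,\pi]$ generated by $e^{ij\theta}$, $j\in\mathbb Z\setminus\{0,\dots,N\}$. A linear estimate of $A_N\xi$ from the observations is $\int_{-\pi}^{\pi}h\,dZ$ with $h\in L_N^\alpha(f)$ (its spectral characteristic), with error $\Delta(h;f)=\int_{-\pi}^{\pi}|A_N(e^{i\theta})-h(\theta)|^\alpha f(\theta)d\theta$, $A_N(e^{i\theta})=\sum_{j=0}^Na(j)e^{ij\theta}$; $h(f)$ denotes the (unique) minimizer of $\Delta(\cdot;f)$ over $L_N^\alpha(f)$, the spectral characteristic of the optimal estimate, and $\Delta(f)=\Delta(h(f);f)$. For a class $D$ of spectral densities: $f_0\in D$ is least favorable in $D$ if $\Delta(h(f_0);f_0)=\max_{f\in D}\Delta(h(f);f)$. A spectral characteristic $h^0$ is minimax (robust) for $D$ if $h^0\in H_D=\bigcap_{f\in D}L_N^\alpha(f)$ and $\min_{h\in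 H_D}\max_{f\in D}\Delta(h;f)=\max_{f\in D}\Delta(h^0;f)$. *)

theory Defs
  imports "HOL-Analysis.Analysis"
begin

definition csigned_power :: "complex \<Rightarrow> real \<Rightarrow> complex" where
  "csigned_power z \<beta> = complex_of_real (cmod z powr (\<beta> - 1)) * cnj z"

abbreviation circle_measure :: "real measure" where
  "circle_measure \<equiv> lebesgue_on {-pi..pi}"

text \<open>
  A harmonizable symmetric \<open>\<alpha>\<close>-stable sequence enters the estimation problem only through its
  finite spectral measure \<open>f d\<theta>\<close>, and every nonnegative integrable \<open>f\<close> is the density of such a
  measure. Densities and spectral characteristics are functions of which only the restriction to
  \<open>[-\<pi>, \<pi>]\<close> matters.
\<close>

definition spectral_density :: "(real \<Rightarrow> real) \<Rightarrow> bool" where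
  "spectral_density f \<longleftrightarrow> integrable circle_measure f \<and> (\<forall>\<theta>\<in>{-pi..pi}. 0 \<le> f \<theta>)"

definition weighted_power_integral :: "real \<Rightarrow> (real \<Rightarrow> real) \<Rightarrow> (real \<Rightarrow> complex) \<Rightarrow> ennreal" where
  "weighted_power_integral \<alpha> f g = (\<integral>\<^sup>+\<theta>. ennreal (cmod (g \<theta>) powr \<alpha> * f \<theta>) \<partial>circle_measure)"

definition L_space :: "real \<Rightarrow> (real \<Rightarrow> real) \<Rightarrow> (real \<Rightarrow> complex) set" where
  "L_space \<alpha> f = {g \<in> borel_measurable circle_measure. weighted_power_integral \<alpha> f g < \<infinity>}"

text \<open>Linear span of the exponentials with frequencies outside \<open>{0, \<dots>, N}\<close>.\<close>

definition observed_span :: "nat \<Rightarrow> (real \<Rightarrow> complex) set" where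
  "observed_span N =
     {\<lambda>\<theta>. \<Sum>j\<in>J. b j * cis (of_int j * \<theta>) | (J :: int set) (b :: int \<Rightarrow> complex).
        finite J \<and> J \<subseteq> - {0..int N}}"

text \<open>
  Its closure in \<open>L\<^sup>\<alpha>(f d\<theta>)\<close>. Elements are functions rather than classes modulo equality
  \<open>f d\<theta>\<close>-almost everywhere.
\<close>

definition observed_space :: "real \<Rightarrow> nat \<Rightarrow> (real \<Rightarrow> real) \<Rightarrow> (real \<Rightarrow> complex) set" where
  "observed_space \<alpha> N f =
     {h \<in> L_space \<alpha> f. \<forall>\<epsilon>>0::real. \<exists>q\<in>observed_span N.
        weighted_power_integral \<alpha> f (\<lambda>\<theta>. h \<theta> - q \<theta>) < ennreal \<epsilon>}"

definition functional_symbol :: "nat \<Rightarrow> (nat \<Rightarrow> complex) \<Rightarrow> real \<Rightarrow> complex" where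
  "functional_symbol N a \<theta> = (\<Sum>j=0..N. a j * cis (real j * \<theta>))"

definition estimation_error ::
  "real \<Rightarrow> nat \<Rightarrow> (nat \<Rightarrow> complex) \<Rightarrow> (real \<Rightarrow> complex) \<Rightarrow> (real \<Rightarrow> real) \<Rightarrow> ennreal" where
  "estimation_error \<alpha> N a h f =
     weighted_power_integral \<alpha> f (\<lambda>\<theta>. functional_symbol N a \<theta> - h \<theta>)"

text \<open>
  The minimizer is unique only up to equality \<open>f d\<theta>\<close>-almost everywhere; \<^const>\<open>arg_min\<close> picks
  one representative, on which the error does not depend.
\<close>

definition optimal_characteristic ::
  "real \<Rightarrow> nat \<Rightarrow> (nat \<Rightarrow> complex) \<Rightarrow> (real \<Rightarrow> real) \<Rightarrow> real \<Rightarrow> complex" where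
  "optimal_characteristic \<alpha> N a f =
     arg_min (\<lambda>h. estimation_error \<alpha> N a h f) (\<lambda>h. h \<in> observed_space \<alpha> N f)"

definition optimal_error :: "real \<Rightarrow> nat \<Rightarrow> (nat \<Rightarrow> complex) \<Rightarrow> (real \<Rightarrow> real) \<Rightarrow> ennreal" where
  "optimal_error \<alpha> N a f = estimation_error \<alpha> N a (optimal_characteristic \<alpha> N a f) f"

definition least_favorable ::
  "real \<Rightarrow> nat \<Rightarrow> (nat \<Rightarrow> complex) \<Rightarrow> (real \<Rightarrow> real) set \<Rightarrow> (real \<Rightarrow> real) \<Rightarrow> bool" where
  "least_favorable \<alpha> N a D f\<^sub>0 \<longleftrightarrow> is_arg_max (optimal_error \<alpha> N a) (\<lambda>f. f \<in> D) f\<^sub>0"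

definition robust_space :: "real \<Rightarrow> nat \<Rightarrow> (real \<Rightarrow> real) set \<Rightarrow> (real \<Rightarrow> complex) set" where
  "robust_space \<alpha> N D = (\<Inter>f\<in>D. observed_space \<alpha> N f)"

text \<open>
  For an arbitrary competitor \<open>h\<close> the error need not attain its supremum over \<open>D\<close>, so the inner
  maximum is a supremum; for the minimax characteristic itself it is required to be attained.
\<close>

definition minimax_characteristic ::
  "real \<Rightarrow> nat \<Rightarrow> (nat \<Rightarrow> complex) \<Rightarrow> (real \<Rightarrow> real) set \<Rightarrow> (real \<Rightarrow> complex) \<Rightarrow> bool" where
  "minimax_characteristic \<alpha> N a D h\<^sub>0 \<longleftrightarrow>
     is_arg_min (\<lambda>h. SUP f\<in>D. estimation_error \<alpha> N a h f) (\<lambda>h. h \<in> robust_space \<alpha> N D) h\<^sub>0 \<and>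
     (\<exists>f. is_arg_max (\<lambda>f. estimation_error \<alpha> N a h\<^sub>0 f) (\<lambda>f. f \<in> D) f)"

definition fixed_power_class :: "real \<Rightarrow> (real \<Rightarrow> real) set" where
  "fixed_power_class P = {f. spectral_density f \<and> (\<integral>\<theta>. f \<theta> \<partial>circle_measure) = P}"

text \<open>
  Positivity almost everywhere is stated explicitly because \<open>0 powr x = 0\<close>, whereas a negative
  power of \<open>0\<close> is to be read as \<open>\<infinity>\<close>.
\<close>

definition minimality_condition :: "real \<Rightarrow> (real \<Rightarrow> real) \<Rightarrow> bool" where
  "minimality_condition \<alpha> f \<longleftrightarrow>
     (AE \<theta> in circle_measure. 0 < f \<theta>) \<and>
     integrable circle_measure (\<lambda>\<theta>. f \<theta> powr (- 1 / (\<alpha> - 1)))"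

text \<open>
  The value at zeros of \<open>f\<close>, where the formula is undefined, is immaterial: under the minimality
  condition they form a null set.
\<close>

definition interpolation_characteristic ::
  "real \<Rightarrow> nat \<Rightarrow> (nat \<Rightarrow> complex) \<Rightarrow> (nat \<Rightarrow> complex) \<Rightarrow> (real \<Rightarrow> real) \<Rightarrow> real \<Rightarrow> complex" where
  "interpolation_characteristic \<alpha> N a c f \<theta> =
     (\<Sum>j=0..N. a j * cis (real j * \<theta>)) -
     csigned_power (complex_of_real (inverse (f \<theta>)) * (\<Sum>j=0..N. c j * cis (- real j * \<theta>)))
       (1 / (\<alpha> - 1))"

end

theory Submission
  imports Defs
begin

text \<open>
  Write \<open>p(\<theta>) = \<Sum>j c(j) e\<^sup>-\<^sup>i\<^sup>j\<^sup>\<theta>\<close>, let \<open>A\<close> be the symbol of the functional and \<open>h\<close> the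
  interpolation characteristic. Since \<open>f\<^sub>0 = C |p|\<close>, the quotient \<open>p / f\<^sub>0\<close> has the constant modulus \<open>1 / C\<close>, so the
  residual is \<open>A - h = K cnj p / |p|\<close> with \<open>K = C\<^bsup>-1/(\<alpha>-1)\<^esup>\<close>: a pure phase of constant modulus \<open>K\<close>
  (\<open>csigned_power_normalized\<close>). Three things follow.

  First, the error of \<open>h\<close> equals \<open>K\<^sup>\<alpha> P\<close> for every density of total power \<open>P\<close>
  (\<open>constant_modulus_error\<close>).

  Second, \<open>h\<close> is admissible for all densities at once. It is bounded, and its Fourier coefficients with index in
  \<open>{0, \<dots>, N}\<close> vanish by the assumed equations; a bounded limit of trigonometric polynomials with these
  properties lies in the observed space of every density, by dominated convergence
  (\<open>bounded_limit_in_observed_space\<close>, \<open>phase_characteristic_in_observed_space\<close>).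

  Third, \<open>h\<close> is optimal for \<open>f\<^sub>0\<close>. Indeed \<open>cnj (A - h) f\<^sub>0 = K C p\<close> has frequencies only in
  \<open>{-N, \<dots>, 0}\<close> and so annihilates the observed space, which is the first-order condition of the
  convex minimization problem (\<open>constant_modulus_residual_optimal\<close>).

  Thus \<open>(h, f\<^sub>0)\<close> is a saddle point with value \<open>K\<^sup>\<alpha> P\<close>: no density of the class has a larger optimal error,
  because \<open>h\<close> is a competitor for it, and no estimate has a smaller worst-case error, because of its error
  at \<open>f\<^sub>0\<close>. To speak of optimal errors and of the optimal characteristic, minimizers have to exist for every
  density and to be unique almost everywhere for \<open>f\<^sub>0\<close>. Both come from the uniform convexity of
  \<open>L\<^sup>\<alpha>(f d\<theta>)\<close>, here derived from a compactness argument in the plane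
  (\<open>cmod_powr_uniform_convexity\<close>, \<open>near_minimizers_close\<close>), together with completeness of the weighted
  space (\<open>weighted_Cauchy_subsequence\<close>).
\<close>

section \<open>Convexity of powers of the modulus\<close>

lemma powr_above_tangent_at_1:
  fixes \<alpha> s :: real
  assumes "1 < \<alpha>" "0 \<le> s" "s \<noteq> 1"
  shows "1 + \<alpha> * (s - 1) < s powr \<alpha>"
proof -
  define F where "F x = x powr \<alpha> - \<alpha> * x" for x :: real
  have D: "(F has_real_derivative \<alpha> * (x powr (\<alpha> - 1) - 1)) (at x)" if "x > 0" for x
    unfolding F_def using that by (auto intro!: derivative_eq_intros simp: algebra_simps)
  have cont: "continuous_on {0..} F"
    unfolding F_def using assms(1) by (intro continuous_intros continuous_on_powr') auto
  have "F 1 < F s"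
  proof (cases "s > 1")
    case True
    have "\<exists>y. (F has_real_derivative y) (at x) \<and> 0 < y" if "1 < x" for x
      using D[of x] that assms(1) by (intro exI[of _ "\<alpha> * (x powr (\<alpha> - 1) - 1)"]) (auto simp: gr_one_powr)
    then show ?thesis
      by (intro DERIV_pos_imp_increasing_open[OF True]) (auto intro: continuous_on_subset[OF cont])
  next
    case False
    then have s: "s < 1" using assms(3) by simp
    have "\<exists>y. (F has_real_derivative y) (at x) \<and> y < 0" if "s < x" "x < 1" for x
    proof -
      have "x powr (\<alpha> - 1) < 1"
        using powr_less_mono2[of "\<alpha> - 1" x 1] that assms by auto
      then show ?thesis
        using D[of x] that assms
        by (intro exI[of _ "\<alpha> * (x powr (\<alpha> - 1) - 1)"]) (auto intro: mult_pos_neg)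
    qed
    then show ?thesis
      by (intro DERIV_neg_imp_decreasing_open[OF s])
         (use assms in \<open>auto intro: continuous_on_subset[OF cont]\<close>)
  qed
  then show ?thesis by (simp add: F_def algebra_simps)
qed

text \<open>
  The tangent at an arbitrary \<open>K > 0\<close> follows from the tangent at \<open>1\<close> because \<open>t\<^sup>\<alpha>\<close> is homogeneous.
  It serves twice: at the midpoint of two points it gives strict convexity, and at the constant modulus
  of a residual it gives optimality.
\<close>

lemma powr_above_tangent:
  fixes \<alpha> K t :: real
  assumes "1 < \<alpha>" "0 < K" "0 \<le> t" "t \<noteq> K"
  shows "K powr \<alpha> + \<alpha> * K powr (\<alpha> - 1) * (t - K) < t powr \<alpha>"
proof -
  have "1 + \<alpha> * (t / K - 1) < (t / K) powr \<alpha>"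
    using assms by (intro powr_above_tangent_at_1) auto
  then have "K powr \<alpha> * (1 + \<alpha> * (t / K - 1)) < K powr \<alpha> * (t / K) powr \<alpha>"
    using assms by (intro mult_strict_left_mono) auto
  moreover have "K powr \<alpha> * (t / K) powr \<alpha> = t powr \<alpha>"
    using assms by (simp add: powr_mult[symmetric])
  moreover have "K powr \<alpha> * (1 + \<alpha> * (t / K - 1)) = K powr \<alpha> + \<alpha> * K powr (\<alpha> - 1) * (t - K)"
    using assms by (simp add: powr_diff field_simps)
  ultimately show ?thesis by simp
qed

lemma powr_midpoint_less:
  fixes \<alpha> x y :: real
  assumes "1 < \<alpha>" "0 \<le> x" "0 \<le> y" "x \<noteq> y"
  shows "((x + y) / 2) powr \<alpha> < (x powr \<alpha> + y powr \<alpha>) / 2"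
proof -
  define K where "K = (x + y) / 2"
  have "0 < K" "x \<noteq> K" "y \<noteq> K"
    using assms by (auto simp: K_def)
  then have "K powr \<alpha> + \<alpha> * K powr (\<alpha> - 1) * (x - K) < x powr \<alpha>"
            "K powr \<alpha> + \<alpha> * K powr (\<alpha> - 1) * (y - K) < y powr \<alpha>"
    using assms by (auto intro: powr_above_tangent)
  moreover have "(x - K) = - (y - K)" by (simp add: K_def field_simps)
  ultimately show ?thesis unfolding K_def[symmetric] by (simp add: algebra_simps)
qed

text \<open>
  Two numbers of equal modulus are separated by strict convexity of the disc, two numbers of different
  modulus by strict convexity of \<open>t\<^sup>\<alpha>\<close>.
\<close>

lemma cmod_midpoint_powr_less:
  fixes a b :: complex
  assumes "1 < \<alpha>" "a \<noteq> b"
  shows "cmod ((a + b) / 2) powr \<alpha> < (cmod a powr \<alpha> + cmod b powr \<alpha>) / 2"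
proof (cases "cmod a = cmod b")
  case True
  have "cmod ((a + b) / 2) < cmod a"
  proof (rule ccontr)
    assume "\<not> ?thesis"
    then have "cmod a + cmod b \<le> cmod (a + b)" using True by (simp add: norm_divide)
    then have "cmod (a + b) = cmod a + cmod b" using norm_triangle_ineq[of a b] by simp
    then have "cmod a *\<^sub>R b = cmod b *\<^sub>R a" by (simp add: norm_triangle_eq)
    with True assms(2) show False by auto
  qed
  then have "cmod ((a + b) / 2) powr \<alpha> < cmod a powr \<alpha>"
    using assms by (intro powr_less_mono2) auto
  then show ?thesis using True by simp
next
  case False
  have "cmod ((a + b) / 2) \<le> (cmod a + cmod b) / 2"
    using norm_triangle_ineq[of a b] by (simp add: norm_divide)
  then have "cmod ((a + b) / 2) powr \<alpha> \<le> ((cmod a + cmod b) / 2) powr \<alpha>"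
    using assms by (intro powr_mono2) auto
  also have "\<dots> < (cmod a powr \<alpha> + cmod b powr \<alpha>) / 2"
    using assms False by (intro powr_midpoint_less) auto
  finally show ?thesis .
qed

text \<open>
  A quantitative form of strict convexity that integrates at once to uniform convexity of
  \<open>L\<^sup>\<alpha>(f d\<theta>)\<close>: up to an arbitrarily small multiple of \<open>|a|\<^sup>\<alpha> + |b|\<^sup>\<alpha>\<close>, the distance of
  \<open>a\<close> and \<open>b\<close> is controlled by the defect in the midpoint inequality. Both sides are homogeneous of
  degree \<open>\<alpha>\<close>, so only the unit sphere matters; there the pairs with
  \<open>|a - b|\<^sup>\<alpha> \<ge> \<epsilon> (|a|\<^sup>\<alpha> + |b|\<^sup>\<alpha>)\<close> form a compact set, on which the defect is bounded away from \<open>0\<close>.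
\<close>

lemma cmod_powr_uniform_convexity:
  fixes \<alpha> \<epsilon> :: real
  assumes \<alpha>: "1 < \<alpha>" and \<epsilon>: "0 < \<epsilon>"
  obtains M where "0 \<le> M" "\<And>a b. cmod (a - b) powr \<alpha> + M * cmod ((a + b) / 2) powr \<alpha>
      \<le> \<epsilon> * (cmod a powr \<alpha> + cmod b powr \<alpha>) + M * ((cmod a powr \<alpha> + cmod b powr \<alpha>) / 2)"
proof -
  \<comment> \<open>\<open>D\<close> is the convexity defect and \<open>E\<close> the excess that it has to dominate.\<close>
  define D where "D z = (cmod (fst z) powr \<alpha> + cmod (snd z) powr \<alpha>) / 2
                        - cmod ((fst z + snd z) / 2) powr \<alpha>" for z :: "complex \<times> complex"
  define E where "E z = cmod (fst z - snd z) powr \<alpha>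
                        - \<epsilon> * (cmod (fst z) powr \<alpha> + cmod (snd z) powr \<alpha>)" for z :: "complex \<times> complex"
  have contD: "continuous_on UNIV D" and contE: "continuous_on UNIV E"
    unfolding D_def E_def using \<alpha>
    by (auto intro!: continuous_intros continuous_on_powr')
  have Dpos: "0 < D z" if "fst z \<noteq> snd z" for z
    using cmod_midpoint_powr_less[OF \<alpha> that] by (simp add: D_def)
  have Dnn: "0 \<le> D z" for z
    using Dpos[of z] by (cases "fst z = snd z") (auto simp: D_def)
  have "closed {z. 0 \<le> E z}"
    by (intro closed_Collect_le continuous_intros contE)
  then have comp: "compact (sphere 0 1 \<inter> {z. 0 \<le> E z})"
    by (intro compact_Int_closed) auto
  have "\<exists>M\<ge>0. \<forall>z\<in>sphere 0 1. E z \<le> M * D z"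
  proof (cases "sphere 0 1 \<inter> {z. 0 \<le> E z} = {}")
    case True
    then show ?thesis by (intro exI[of _ 0]) (force simp: not_le)
  next
    case False
    then obtain z0 where "z0 \<in> sphere 0 1 \<inter> {z. 0 \<le> E z}"
      and "\<forall>z\<in>sphere 0 1 \<inter> {z. 0 \<le> E z}. D z0 \<le> D z"
      using continuous_attains_inf[OF comp False continuous_on_subset[OF contD subset_UNIV]] by blast
    then have z0: "z0 \<in> sphere 0 1" "0 \<le> E z0"
      and min: "\<And>z. z \<in> sphere 0 1 \<Longrightarrow> 0 \<le> E z \<Longrightarrow> D z0 \<le> D z"
      by blast+
    have "fst z0 \<noteq> snd z0"
    proof
      assume eq: "fst z0 = snd z0"
      then have "snd z0 = 0" using z0(2) \<epsilon> \<alpha> by (auto simp: E_def mult_le_0_iff)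
      then show False using z0(1) eq by (cases z0) (auto simp: norm_Pair)
    qed
    then have m: "0 < D z0" by (rule Dpos)
    have "E z \<le> 2 powr \<alpha> / D z0 * D z" if z: "z \<in> sphere 0 1" for z
    proof (cases "0 \<le> E z")
      case True
      have "cmod (fst z - snd z) \<le> cmod (fst z) + cmod (snd z)" by (rule norm_triangle_ineq4)
      also have "\<dots> \<le> 2" using norm_fst_le[of "fst z" "snd z"] norm_snd_le[of "snd z" "fst z"] z by auto
      finally have "cmod (fst z - snd z) powr \<alpha> \<le> 2 powr \<alpha>" using \<alpha> by (intro powr_mono2) auto
      moreover have "0 \<le> \<epsilon> * (cmod (fst z) powr \<alpha> + cmod (snd z) powr \<alpha>)" using \<epsilon> by simp
      ultimately have "E z \<le> 2 powr \<alpha>" by (simp add: E_def)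
      also have "\<dots> = 2 powr \<alpha> / D z0 * D z0" using m by simp
      also have "\<dots> \<le> 2 powr \<alpha> / D z0 * D z"
        using min[OF z True] m by (intro mult_left_mono) auto
      finally show ?thesis .
    next
      case False
      moreover have "0 \<le> 2 powr \<alpha> / D z0 * D z" using m Dnn by simp
      ultimately show ?thesis by linarith
    qed
    then show ?thesis using m by (intro exI[of _ "2 powr \<alpha> / D z0"]) auto
  qed
  then obtain M where M: "0 \<le> M" "\<And>z. z \<in> sphere 0 1 \<Longrightarrow> E z \<le> M * D z" by blast
  have hom: "F (r *\<^sub>R z) = r powr \<alpha> * F z" if "F = D \<or> F = E" "0 \<le> r" for F r z
  proof -
    have *: "cmod (of_real r * x) powr \<alpha> = r powr \<alpha> * cmod x powr \<alpha>" for x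
      using that by (simp add: norm_mult powr_mult)
    have 1: "r *\<^sub>R fst z - r *\<^sub>R snd z = of_real r * (fst z - snd z)"
      and 2: "(r *\<^sub>R fst z + r *\<^sub>R snd z) / 2 = of_real r * ((fst z + snd z) / 2)"
      by (simp_all add: scaleR_conv_of_real algebra_simps)
    from that(1) show ?thesis
    proof
      assume "F = D"
      then show ?thesis
        unfolding D_def by (simp only: fst_scaleR snd_scaleR 2, simp only: scaleR_conv_of_real *)
           (simp add: algebra_simps)
    next
      assume "F = E"
      then show ?thesis
        unfolding E_def by (simp only: fst_scaleR snd_scaleR 1, simp only: scaleR_conv_of_real *)
           (simp add: algebra_simps)
    qed
  qed
  have key: "E z \<le> M * D z" for z
  proof (cases "z = 0")
    case True
    then show ?thesis using \<alpha> by (simp add: E_def D_def)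
  next
    case False
    define w where "w = z /\<^sub>R norm z"
    have "E (norm z *\<^sub>R w) \<le> M * D (norm z *\<^sub>R w)"
      using mult_left_mono[OF M(2)[of w], of "norm z powr \<alpha>"] False
      by (simp add: hom w_def algebra_simps)
    then show ?thesis using False by (simp add: w_def)
  qed
  show ?thesis
  proof (rule that[OF M(1)])
    fix a b :: complex
    show "cmod (a - b) powr \<alpha> + M * cmod ((a + b) / 2) powr \<alpha>
      \<le> \<epsilon> * (cmod a powr \<alpha> + cmod b powr \<alpha>) + M * ((cmod a powr \<alpha> + cmod b powr \<alpha>) / 2)"
      using key[of "(a, b)"] by (simp add: E_def D_def right_diff_distrib)
  qed
qed

section \<open>Weighted spaces and the observed subspace\<close>

lemma spectral_densityD:
  assumes "spectral_density f"
  shows "f \<in> borel_measurable circle_measure" "integrable circle_measure f"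
    "\<And>\<theta>. \<theta> \<in> {-pi..pi} \<Longrightarrow> 0 \<le> f \<theta>"
  using assms by (auto simp: spectral_density_def)

lemma continuous_on_measurable_circle:
  fixes g :: "real \<Rightarrow> 'b::topological_space"
  shows "continuous_on UNIV g \<Longrightarrow> g \<in> borel_measurable circle_measure"
  by (rule continuous_imp_measurable_on_sets_lebesgue) (auto intro: continuous_on_subset)

lemma weighted_power_integral_cong_AE:
  assumes "AE \<theta> in circle_measure. g \<theta> = h \<theta>"
  shows "weighted_power_integral \<alpha> f g = weighted_power_integral \<alpha> f h"
  unfolding weighted_power_integral_def
  using assms by (intro nn_integral_cong_AE) auto

text \<open>
  A pointwise inequality between \<open>\<alpha>\<close>-th powers passes to the weighted integrals. The quasi-triangle
  inequality and the uniform convexity of the weighted space are both instances.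
\<close>

lemma weighted_power_integral_combine:
  assumes f: "spectral_density f"
    and meas: "u \<in> borel_measurable circle_measure" "v \<in> borel_measurable circle_measure"
      "x \<in> borel_measurable circle_measure" "y \<in> borel_measurable circle_measure"
    and nn: "0 \<le> A" "0 \<le> B" "0 \<le> C" "0 \<le> D"
    and le: "\<And>\<theta>. \<theta> \<in> {-pi..pi} \<Longrightarrow> A * cmod (u \<theta>) powr \<alpha> + B * cmod (v \<theta>) powr \<alpha>
               \<le> C * cmod (x \<theta>) powr \<alpha> + D * cmod (y \<theta>) powr \<alpha>"
  shows "ennreal A * weighted_power_integral \<alpha> f u + ennreal B * weighted_power_integral \<alpha> f v
       \<le> ennreal C * weighted_power_integral \<alpha> f x + ennreal D * weighted_power_integral \<alpha> f y"
proof -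
  note [measurable] = meas spectral_densityD(1)[OF f]
  have "ennreal A * weighted_power_integral \<alpha> f u + ennreal B * weighted_power_integral \<alpha> f v
    = (\<integral>\<^sup>+\<theta>. ennreal A * ennreal (cmod (u \<theta>) powr \<alpha> * f \<theta>)
           + ennreal B * ennreal (cmod (v \<theta>) powr \<alpha> * f \<theta>) \<partial>circle_measure)"
    unfolding weighted_power_integral_def
    by (subst nn_integral_add) (auto simp: nn_integral_cmult)
  also have "\<dots> \<le> (\<integral>\<^sup>+\<theta>. ennreal C * ennreal (cmod (x \<theta>) powr \<alpha> * f \<theta>)
           + ennreal D * ennreal (cmod (y \<theta>) powr \<alpha> * f \<theta>) \<partial>circle_measure)"
  proof (rule nn_integral_mono)
    fix \<theta> assume "\<theta> \<in> space circle_measure"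
    then have \<theta>: "\<theta> \<in> {-pi..pi}" by simp
    have f0: "0 \<le> f \<theta>" using spectral_densityD(3)[OF f \<theta>] .
    have "(A * cmod (u \<theta>) powr \<alpha> + B * cmod (v \<theta>) powr \<alpha>) * f \<theta>
        \<le> (C * cmod (x \<theta>) powr \<alpha> + D * cmod (y \<theta>) powr \<alpha>) * f \<theta>"
      by (intro mult_right_mono le \<theta> f0)
    then show "ennreal A * ennreal (cmod (u \<theta>) powr \<alpha> * f \<theta>)
           + ennreal B * ennreal (cmod (v \<theta>) powr \<alpha> * f \<theta>)
         \<le> ennreal C * ennreal (cmod (x \<theta>) powr \<alpha> * f \<theta>)
           + ennreal D * ennreal (cmod (y \<theta>) powr \<alpha> * f \<theta>)"
      using nn f0 by (simp add: ennreal_mult[symmetric] ennreal_plus[symmetric] algebra_simps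
          del: ennreal_plus)
  qed
  also have "\<dots> = ennreal C * weighted_power_integral \<alpha> f x + ennreal D * weighted_power_integral \<alpha> f y"
    unfolding weighted_power_integral_def
    by (subst nn_integral_add) (auto simp: nn_integral_cmult)
  finally show ?thesis .
qed

text \<open>
  The crude constant \<open>2\<^sup>\<alpha>\<close> suffices, as only smallness and finiteness of the integrals are at stake.
\<close>

lemma cmod_add_powr_le:
  fixes a b :: complex
  assumes "0 \<le> \<alpha>"
  shows "cmod (a + b) powr \<alpha> \<le> 2 powr \<alpha> * cmod a powr \<alpha> + 2 powr \<alpha> * cmod b powr \<alpha>"
proof -
  have "cmod (a + b) \<le> 2 * max (cmod a) (cmod b)"
    using norm_triangle_ineq[of a b] by linarith
  then have "cmod (a + b) powr \<alpha> \<le> (2 * max (cmod a) (cmod b)) powr \<alpha>"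
    using assms by (intro powr_mono2) auto
  also have "\<dots> \<le> 2 powr \<alpha> * cmod a powr \<alpha> + 2 powr \<alpha> * cmod b powr \<alpha>"
    by (cases "cmod a \<le> cmod b") (auto simp: powr_mult max_def)
  finally show ?thesis .
qed

lemma weighted_power_integral_add_le:
  assumes "spectral_density f" "0 \<le> \<alpha>"
    and "u \<in> borel_measurable circle_measure" "v \<in> borel_measurable circle_measure"
  shows "weighted_power_integral \<alpha> f (\<lambda>\<theta>. u \<theta> + v \<theta>)
     \<le> ennreal (2 powr \<alpha>) * (weighted_power_integral \<alpha> f u + weighted_power_integral \<alpha> f v)"
  using weighted_power_integral_combine[of f "\<lambda>\<theta>. u \<theta> + v \<theta>" u u v 1 0 "2 powr \<alpha>" "2 powr \<alpha>" \<alpha>]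
    assms cmod_add_powr_le[of \<alpha>]
  by (auto simp: distrib_left)

lemma L_space_iff:
  "g \<in> L_space \<alpha> f \<longleftrightarrow> g \<in> borel_measurable circle_measure \<and> weighted_power_integral \<alpha> f g < \<infinity>"
  by (simp add: L_space_def)

lemma bounded_in_L_space:
  assumes f: "spectral_density f" and \<alpha>: "0 \<le> \<alpha>" and g: "g \<in> borel_measurable circle_measure"
    and B: "\<And>\<theta>. \<theta> \<in> {-pi..pi} \<Longrightarrow> cmod (g \<theta>) \<le> B"
  shows "g \<in> L_space \<alpha> f"
proof -
  have "weighted_power_integral \<alpha> f g \<le> (\<integral>\<^sup>+\<theta>. ennreal (B powr \<alpha> * f \<theta>) \<partial>circle_measure)"
    unfolding weighted_power_integral_def
    by (intro nn_integral_mono ennreal_leI mult_right_mono powr_mono2)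
       (use B \<alpha> spectral_densityD(3)[OF f] in auto)
  also have "\<dots> < \<infinity>"
  proof -
    have "integrable circle_measure (\<lambda>\<theta>. B powr \<alpha> * f \<theta>)"
      using spectral_densityD(2)[OF f] by simp
    then have "(\<integral>\<^sup>+\<theta>. ennreal (norm (B powr \<alpha> * f \<theta>)) \<partial>circle_measure) < \<infinity>"
      unfolding integrable_iff_bounded by blast
    moreover have "(\<integral>\<^sup>+\<theta>. ennreal (norm (B powr \<alpha> * f \<theta>)) \<partial>circle_measure)
       = (\<integral>\<^sup>+\<theta>. ennreal (B powr \<alpha> * f \<theta>) \<partial>circle_measure)"
      using spectral_densityD(3)[OF f] by (intro nn_integral_cong) auto
    ultimately show ?thesis by simp
  qed
  finally show ?thesis using g by (simp add: L_space_iff)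
qed

lemma L_space_add:
  assumes "spectral_density f" "0 \<le> \<alpha>" "u \<in> L_space \<alpha> f" "v \<in> L_space \<alpha> f"
  shows "(\<lambda>\<theta>. u \<theta> + v \<theta>) \<in> L_space \<alpha> f"
  using weighted_power_integral_add_le[of f \<alpha> u v] assms
  by (auto simp: L_space_iff ennreal_mult_less_top intro: le_less_trans)

lemma weighted_power_integral_cmult:
  assumes "spectral_density f" "g \<in> borel_measurable circle_measure"
  shows "weighted_power_integral \<alpha> f (\<lambda>\<theta>. c * g \<theta>)
       = ennreal (cmod c powr \<alpha>) * weighted_power_integral \<alpha> f g"
proof -
  note [measurable] = assms(2) spectral_densityD(1)[OF assms(1)]
  show ?thesis
    unfolding weighted_power_integral_def
    by (subst nn_integral_cmult[symmetric])
       (auto simp: norm_mult powr_mult ennreal_mult'[symmetric] mult.assoc)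
qed

lemma L_space_cmult:
  assumes "spectral_density f" "g \<in> L_space \<alpha> f"
  shows "(\<lambda>\<theta>. c * g \<theta>) \<in> L_space \<alpha> f"
  using assms by (auto simp: L_space_iff weighted_power_integral_cmult ennreal_mult_less_top)

lemma L_space_diff:
  assumes "spectral_density f" "0 \<le> \<alpha>" "u \<in> L_space \<alpha> f" "v \<in> L_space \<alpha> f"
  shows "(\<lambda>\<theta>. u \<theta> - v \<theta>) \<in> L_space \<alpha> f"
  using L_space_add[OF assms(1,2,3) L_space_cmult[OF assms(1,4), of "-1"]] by simp

lemma observed_spanI:
  "finite J \<Longrightarrow> J \<subseteq> - {0..int N} \<Longrightarrow>
     (\<lambda>\<theta>. \<Sum>j\<in>J. b j * cis (of_int j * \<theta>)) \<in> observed_span N"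
  unfolding observed_span_def by blast

lemma observed_span_add:
  assumes "p \<in> observed_span N" "q \<in> observed_span N"
  shows "(\<lambda>\<theta>. p \<theta> + q \<theta>) \<in> observed_span N"
proof -
  obtain J b where p: "finite J" "J \<subseteq> - {0..int N}" "p = (\<lambda>\<theta>. \<Sum>j\<in>J. b j * cis (of_int j * \<theta>))"
    using assms(1) by (auto simp: observed_span_def)
  obtain I d where q: "finite I" "I \<subseteq> - {0..int N}" "q = (\<lambda>\<theta>. \<Sum>j\<in>I. d j * cis (of_int j * \<theta>))"
    using assms(2) by (auto simp: observed_span_def)
  have "(\<lambda>\<theta>. p \<theta> + q \<theta>) = (\<lambda>\<theta>. \<Sum>j\<in>J \<union> I. ((if j \<in> J then b j else 0) + (if j \<in> I then d j else 0))
            * cis (of_int j * \<theta>))"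
  proof
    fix \<theta>
    have "(\<Sum>j\<in>J \<union> I. (if j \<in> J then b j else 0) * cis (of_int j * \<theta>)) = p \<theta>"
      unfolding p(3) using p(1) q(1) by (intro sum.mono_neutral_cong_right) auto
    moreover have "(\<Sum>j\<in>J \<union> I. (if j \<in> I then d j else 0) * cis (of_int j * \<theta>)) = q \<theta>"
      unfolding q(3) using p(1) q(1) by (intro sum.mono_neutral_cong_right) auto
    ultimately show "p \<theta> + q \<theta> = (\<Sum>j\<in>J \<union> I. ((if j \<in> J then b j else 0)
        + (if j \<in> I then d j else 0)) * cis (of_int j * \<theta>))"
      by (simp add: distrib_right sum.distrib)
  qed
  then show ?thesis using p q observed_spanI[of "J \<union> I" N] by simp
qed

lemma observed_span_cmult:
  assumes "p \<in> observed_span N"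
  shows "(\<lambda>\<theta>. c * p \<theta>) \<in> observed_span N"
proof -
  obtain J b where p: "finite J" "J \<subseteq> - {0..int N}" "p = (\<lambda>\<theta>. \<Sum>j\<in>J. b j * cis (of_int j * \<theta>))"
    using assms(1) by (auto simp: observed_span_def)
  show ?thesis
    using observed_spanI[OF p(1,2), of "\<lambda>j. c * b j"] by (simp add: p(3) sum_distrib_left mult.assoc)
qed

lemma observed_span_continuous:
  assumes "p \<in> observed_span N"
  shows "continuous_on UNIV p"
  using assms by (auto simp: observed_span_def intro!: continuous_intros)

lemma observed_span_bounded:
  assumes "p \<in> observed_span N"
  obtains B where "\<And>\<theta>. cmod (p \<theta>) \<le> B"
proof -
  obtain J b where p: "p = (\<lambda>\<theta>. \<Sum>j\<in>J. b j * cis (of_int j * \<theta>))"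
    using assms(1) by (auto simp: observed_span_def)
  have "cmod (p \<theta>) \<le> (\<Sum>j\<in>J. cmod (b j))" for \<theta>
    unfolding p by (rule sum_norm_le) (simp add: norm_mult)
  then show ?thesis by (rule that)
qed

lemma observed_span_in_L_space:
  assumes "spectral_density f" "0 \<le> \<alpha>" "p \<in> observed_span N"
  shows "p \<in> L_space \<alpha> f"
proof -
  obtain B where "\<And>\<theta>. cmod (p \<theta>) \<le> B" using observed_span_bounded[OF assms(3)] by blast
  then show ?thesis
    using assms by (intro bounded_in_L_space[where B = B] continuous_on_measurable_circle)
       (auto intro: observed_span_continuous)
qed

lemma observed_space_measurable:
  "g \<in> observed_space \<alpha> N f \<Longrightarrow> g \<in> borel_measurable circle_measure"
  by (simp add: observed_space_def L_space_iff)

text \<open>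
  The closure is closed: a function at finite distance from an element of the space inherits
  integrability from it, and two approximations compose.
\<close>

lemma observed_space_closed:
  assumes f: "spectral_density f" and \<alpha>: "0 \<le> \<alpha>" and h: "h \<in> borel_measurable circle_measure"
    and approx: "\<And>e::real. 0 < e \<Longrightarrow>
      \<exists>g\<in>observed_space \<alpha> N f. weighted_power_integral \<alpha> f (\<lambda>\<theta>. h \<theta> - g \<theta>) < ennreal e"
  shows "h \<in> observed_space \<alpha> N f"
proof -
  obtain g where g: "g \<in> observed_space \<alpha> N f"
    "weighted_power_integral \<alpha> f (\<lambda>\<theta>. h \<theta> - g \<theta>) < ennreal 1"
    using approx[of 1] by auto
  have "(\<lambda>\<theta>. (h \<theta> - g \<theta>) + g \<theta>) \<in> L_space \<alpha> f"
    using g h by (intro L_space_add f \<alpha>) (auto simp: L_space_iff observed_space_def less_top[symmetric] elim: order_less_trans)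
  then have L: "h \<in> L_space \<alpha> f" by simp
  have "\<exists>q\<in>observed_span N. weighted_power_integral \<alpha> f (\<lambda>\<theta>. h \<theta> - q \<theta>) < ennreal e" if "e > 0" for e
  proof -
    define e' where "e' = e / (2 * 2 powr \<alpha>)"
    have e': "e' > 0" using that by (simp add: e'_def)
    obtain g where g: "g \<in> observed_space \<alpha> N f"
      "weighted_power_integral \<alpha> f (\<lambda>\<theta>. h \<theta> - g \<theta>) < ennreal e'"
      using approx[OF e'] by auto
    obtain q where q: "q \<in> observed_span N" "weighted_power_integral \<alpha> f (\<lambda>\<theta>. g \<theta> - q \<theta>) < ennreal e'"
      using g(1) e' by (auto simp: observed_space_def)
    note [measurable] = h observed_space_measurable[OF g(1)]
      continuous_on_measurable_circle[OF observed_span_continuous[OF q(1)]]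
    have "weighted_power_integral \<alpha> f (\<lambda>\<theta>. (h \<theta> - g \<theta>) + (g \<theta> - q \<theta>))
       \<le> ennreal (2 powr \<alpha>) * (weighted_power_integral \<alpha> f (\<lambda>\<theta>. h \<theta> - g \<theta>)
                                + weighted_power_integral \<alpha> f (\<lambda>\<theta>. g \<theta> - q \<theta>))"
      by (rule weighted_power_integral_add_le[OF f \<alpha>]) measurable
    also have "\<dots> < ennreal (2 powr \<alpha>) * (ennreal e' + ennreal e')"
      using g(2) q(2) by (intro ennreal_mult_strict_left_mono add_strict_mono) auto
    also have "\<dots> = ennreal e"
      using e' that by (simp add: ennreal_plus[symmetric] ennreal_mult'[symmetric] e'_def del: ennreal_plus)
    finally show ?thesis using q(1) by (intro bexI[of _ q]) auto
  qed
  then show ?thesis using L by (auto simp: observed_space_def)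
qed

lemma observed_span_subset_space:
  assumes "spectral_density f" "0 \<le> \<alpha>" "p \<in> observed_span N"
  shows "p \<in> observed_space \<alpha> N f"
  unfolding observed_space_def
  using observed_span_in_L_space[OF assms] assms(3)
  by (auto intro!: bexI[of _ p] simp: weighted_power_integral_def)

lemma zero_in_observed_space:
  assumes "spectral_density f" "0 \<le> \<alpha>"
  shows "(\<lambda>_. 0) \<in> observed_space \<alpha> N f"
  using observed_span_subset_space[OF assms, of "\<lambda>_. 0" N] observed_spanI[of "{}" N] by simp

text \<open>
  Convexity of the feasible set, in the only form that the existence of a minimizer requires.
\<close>

lemma observed_space_midpoint:
  assumes f: "spectral_density f" and \<alpha>: "0 \<le> \<alpha>"
    and g: "g \<in> observed_space \<alpha> N f" and h: "h \<in> observed_space \<alpha> N f"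
  shows "(\<lambda>\<theta>. (g \<theta> + h \<theta>) / 2) \<in> observed_space \<alpha> N f"
proof (rule observed_space_closed[OF f \<alpha>])
  note [measurable] = observed_space_measurable[OF g] observed_space_measurable[OF h]
  show "(\<lambda>\<theta>. (g \<theta> + h \<theta>) / 2) \<in> borel_measurable circle_measure" by measurable
  fix e :: real assume e: "0 < e"
  then have e2: "e / 2 > 0" by simp
  obtain p where p: "p \<in> observed_span N" "weighted_power_integral \<alpha> f (\<lambda>\<theta>. g \<theta> - p \<theta>) < ennreal (e/2)"
    using g e2 unfolding observed_space_def by blast
  obtain q where q: "q \<in> observed_span N" "weighted_power_integral \<alpha> f (\<lambda>\<theta>. h \<theta> - q \<theta>) < ennreal (e/2)"
    using h e2 unfolding observed_space_def by blast
  note [measurable] = continuous_on_measurable_circle[OF observed_span_continuous[OF q(1)]]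
     continuous_on_measurable_circle[OF observed_span_continuous[OF p(1)]]
  have in_sp: "(\<lambda>\<theta>. (p \<theta> + q \<theta>) / 2) \<in> observed_space \<alpha> N f"
    using observed_span_subset_space[OF f \<alpha> observed_span_cmult[OF observed_span_add[OF p(1) q(1)], of "1/2"]]
    by simp
  have "weighted_power_integral \<alpha> f (\<lambda>\<theta>. (g \<theta> - p \<theta>) / 2 + (h \<theta> - q \<theta>) / 2)
     \<le> ennreal (2 powr \<alpha>) * (weighted_power_integral \<alpha> f (\<lambda>\<theta>. (g \<theta> - p \<theta>) / 2)
                                + weighted_power_integral \<alpha> f (\<lambda>\<theta>. (h \<theta> - q \<theta>) / 2))"
    by (rule weighted_power_integral_add_le[OF f \<alpha>]) measurable
  also have "\<dots> = weighted_power_integral \<alpha> f (\<lambda>\<theta>. g \<theta> - p \<theta>) + weighted_power_integral \<alpha> f (\<lambda>\<theta>. h \<theta> - q \<theta>)"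
    using weighted_power_integral_cmult[OF f, of "\<lambda>\<theta>. g \<theta> - p \<theta>" \<alpha> "1/2"]
      weighted_power_integral_cmult[OF f, of "\<lambda>\<theta>. h \<theta> - q \<theta>" \<alpha> "1/2"]
    by (simp add: distrib_left[symmetric] mult.assoc[symmetric] ennreal_mult'[symmetric] powr_mult[symmetric])
  also have "\<dots> < ennreal (e/2) + ennreal (e/2)"
    using p(2) q(2) by (rule add_strict_mono)
  also have "\<dots> = ennreal e" using e by (simp add: ennreal_plus[symmetric] del: ennreal_plus)
  finally show "\<exists>g'\<in>observed_space \<alpha> N f. weighted_power_integral \<alpha> f (\<lambda>\<theta>. (g \<theta> + h \<theta>) / 2 - g' \<theta>) < ennreal e"
    by (intro bexI[OF _ in_sp]) (simp add: field_simps)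
qed

section \<open>Existence and uniqueness of best approximations\<close>

text \<open>
  Fatou's lemma. Convergence is irrelevant where the density vanishes, so it is demanded only
  almost everywhere with respect to \<open>f d\<theta>\<close>; the disjunction \<open>f \<theta> = 0\<close> expresses this.
\<close>

lemma weighted_power_integral_le_liminf:
  fixes g :: "nat \<Rightarrow> real \<Rightarrow> complex"
  assumes f: "f \<in> borel_measurable circle_measure" and \<alpha>: "0 < \<alpha>"
    and g: "\<And>k. g k \<in> borel_measurable circle_measure"
    and lim: "AE \<theta> in circle_measure. f \<theta> = 0 \<or> (\<lambda>k. g k \<theta>) \<longlonglongrightarrow> G \<theta>"
  shows "weighted_power_integral \<alpha> f G \<le> liminf (\<lambda>k. weighted_power_integral \<alpha> f (g k))"
proof -
  note [measurable] = f g
  have "weighted_power_integral \<alpha> f G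
     \<le> (\<integral>\<^sup>+\<theta>. liminf (\<lambda>k. ennreal (cmod (g k \<theta>) powr \<alpha> * f \<theta>)) \<partial>circle_measure)"
    unfolding weighted_power_integral_def
  proof (rule nn_integral_mono_AE, use lim in eventually_elim)
    fix \<theta> assume "f \<theta> = 0 \<or> (\<lambda>k. g k \<theta>) \<longlonglongrightarrow> G \<theta>"
    then show "ennreal (cmod (G \<theta>) powr \<alpha> * f \<theta>) \<le> liminf (\<lambda>k. ennreal (cmod (g k \<theta>) powr \<alpha> * f \<theta>))"
    proof
      assume "(\<lambda>k. g k \<theta>) \<longlonglongrightarrow> G \<theta>"
      then have "(\<lambda>k. ennreal (cmod (g k \<theta>) powr \<alpha> * f \<theta>)) \<longlonglongrightarrow> ennreal (cmod (G \<theta>) powr \<alpha> * f \<theta>)"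
        using \<alpha> by (intro tendsto_ennrealI tendsto_mult tendsto_powr' tendsto_norm tendsto_const) auto
      then show ?thesis by (simp add: lim_imp_Liminf)
    qed auto
  qed
  also have "\<dots> \<le> liminf (\<lambda>k. weighted_power_integral \<alpha> f (g k))"
    unfolding weighted_power_integral_def by (rule nn_integral_liminf) measurable
  finally show ?thesis .
qed

lemma fast_Cauchy_convergent:
  fixes x :: "nat \<Rightarrow> complex"
  assumes "\<And>k. cmod (x (Suc k) - x k) \<le> B * (1 / 2) ^ k"
  shows "convergent x"
proof -
  have "summable (\<lambda>k. B * (1 / 2 :: real) ^ k)"
    by (intro summable_mult summable_geometric) auto
  then have "summable (\<lambda>k. x (Suc k) - x k)"
    by (rule summable_comparison_test'[where N = 0]) (use assms in simp)
  then have "convergent (\<lambda>n. \<Sum>k<n. x (Suc k) - x k)"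
    by (simp add: summable_iff_convergent)
  then have "convergent (\<lambda>n. x n - x 0)" by (simp add: sum_lessThan_telescope)
  then show ?thesis by (simp add: convergent_diff_const_right_iff)
qed

text \<open>
  The Riesz--Fischer argument: along a subsequence whose increments decrease fast enough, even the
  series of the \<open>\<alpha>\<close>-th powers of the increments amplified by \<open>2\<^sup>k\<close> has a finite integral. It is therefore
  finite almost everywhere, which forces geometric decay of the increments at almost every point of
  positive density.
\<close>

lemma weighted_Cauchy_subsequence:
  fixes g :: "nat \<Rightarrow> real \<Rightarrow> complex"
  assumes f: "spectral_density f" and \<alpha>: "0 < \<alpha>"
    and g: "\<And>k. g k \<in> borel_measurable circle_measure"
    and Cauchy: "\<And>e::real. 0 < e \<Longrightarrow>
      \<exists>n0. \<forall>m\<ge>n0. \<forall>n\<ge>n0. weighted_power_integral \<alpha> f (\<lambda>\<theta>. g m \<theta> - g n \<theta>) < ennreal e"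
  obtains r G where "strict_mono r" "G \<in> borel_measurable circle_measure"
    "AE \<theta> in circle_measure. f \<theta> = 0 \<or> (\<lambda>k. g (r k) \<theta>) \<longlonglongrightarrow> G \<theta>"
proof -
  \<comment> \<open>The factor \<open>(2\<^sup>k)\<^sup>-\<^sup>\<alpha>\<close> pays for the amplification by \<open>2\<^sup>k\<close> of the
    \<open>k\<close>-th increment in \<open>u\<close>, and \<open>2\<^sup>-\<^sup>k\<close> makes the resulting series converge.\<close>
  define \<delta> where "\<delta> k = (1/2) ^ k / (2 ^ k) powr \<alpha>" for k :: nat
  have \<delta>: "\<delta> k > 0" for k by (simp add: \<delta>_def)
  obtain n0 :: "nat \<Rightarrow> nat" where n0: "\<And>k m n. m \<ge> n0 k \<Longrightarrow> n \<ge> n0 k \<Longrightarrow>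
      weighted_power_integral \<alpha> f (\<lambda>\<theta>. g m \<theta> - g n \<theta>) < ennreal (\<delta> k)"
    using Cauchy[OF \<delta>] by metis
  define r where "r k = (\<Sum>i\<le>k. n0 i) + k" for k
  have r: "strict_mono r" by (auto simp: strict_mono_Suc_iff r_def)
  have rn: "n0 k \<le> r k" for k unfolding r_def by (simp add: trans_le_add1 member_le_sum)
  have rn': "n0 k \<le> r (Suc k)" for k
    using rn[of k] strict_monoD[OF r, of k "Suc k"] by simp
  note [measurable] = g spectral_densityD(1)[OF f]
  define u where "u k \<theta> = ennreal ((2 ^ k) powr \<alpha>)
      * ennreal (cmod (g (r (Suc k)) \<theta> - g (r k) \<theta>) powr \<alpha> * f \<theta>)" for k \<theta>
  have u_meas [measurable]: "u k \<in> borel_measurable circle_measure" for k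
    unfolding u_def by measurable
  have "(\<integral>\<^sup>+\<theta>. u k \<theta> \<partial>circle_measure) \<le> ennreal ((1/2) ^ k)" for k
  proof -
    have "(\<integral>\<^sup>+\<theta>. u k \<theta> \<partial>circle_measure) = ennreal ((2 ^ k) powr \<alpha>)
        * weighted_power_integral \<alpha> f (\<lambda>\<theta>. g (r (Suc k)) \<theta> - g (r k) \<theta>)"
      unfolding u_def weighted_power_integral_def by (rule nn_integral_cmult) measurable
    also have "\<dots> \<le> ennreal ((2 ^ k) powr \<alpha>) * ennreal (\<delta> k)"
      using n0[OF rn' rn] by (intro mult_left_mono less_imp_le) auto
    also have "\<dots> = ennreal ((1/2) ^ k)"
      by (simp add: ennreal_mult'[symmetric] \<delta>_def)
    finally show ?thesis .
  qed
  then have "(\<integral>\<^sup>+\<theta>. (\<Sum>k. u k \<theta>) \<partial>circle_measure) \<le> (\<Sum>k. ennreal ((1/2) ^ k))"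
    by (subst nn_integral_suminf) (auto intro: suminf_le)
  also have "\<dots> = ennreal (\<Sum>k. (1/2) ^ k)"
    by (intro suminf_ennreal2 summable_geometric) auto
  also have "\<dots> < \<infinity>" by simp
  finally have "AE \<theta> in circle_measure. (\<Sum>k. u k \<theta>) \<noteq> \<infinity>"
    by (intro nn_integral_PInf_AE) auto
  moreover have "AE \<theta> in circle_measure. \<theta> \<in> {-pi..pi}"
    using AE_space[of circle_measure] by simp
  ultimately have "AE \<theta> in circle_measure. f \<theta> = 0 \<or> (\<lambda>k. g (r k) \<theta>) \<longlonglongrightarrow> lim (\<lambda>k. g (r k) \<theta>)"
  proof eventually_elim
    case (elim \<theta>)
    show ?case
    proof (cases "f \<theta> = 0")
      case False
      then have f0: "0 < f \<theta>" using spectral_densityD(3)[OF f elim(2)] by simp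
      define S where "S = enn2real (\<Sum>k. u k \<theta>)"
      have S: "(\<Sum>k. u k \<theta>) = ennreal S" "0 \<le> S"
        using elim(1) by (auto simp: S_def less_top)
      have "cmod (g (r (Suc k)) \<theta> - g (r k) \<theta>) \<le> (S / f \<theta>) powr (1 / \<alpha>) * (1/2) ^ k" for k
      proof -
        define d where "d = cmod (g (r (Suc k)) \<theta> - g (r k) \<theta>)"
        have "u k \<theta> \<le> (\<Sum>k. u k \<theta>)" using sum_le_suminf[of "\<lambda>k. u k \<theta>" "{k}"] by simp
        then have "ennreal ((2 ^ k) powr \<alpha> * (d powr \<alpha> * f \<theta>)) \<le> ennreal S"
          using f0 unfolding S(1) by (simp add: u_def d_def ennreal_mult'[symmetric])
        then have "(2 ^ k * d) powr \<alpha> * f \<theta> \<le> S"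
          using S by (simp add: d_def powr_mult mult.assoc)
        then have "(2 ^ k * d) powr \<alpha> \<le> S / f \<theta>" using f0 by (simp add: field_simps)
        then have "((2 ^ k * d) powr \<alpha>) powr (1 / \<alpha>) \<le> (S / f \<theta>) powr (1 / \<alpha>)"
          using \<alpha> by (intro powr_mono2) auto
        then have "2 ^ k * d \<le> (S / f \<theta>) powr (1 / \<alpha>)"
          using \<alpha> by (simp add: powr_powr d_def)
        then show ?thesis by (simp add: d_def power_divide field_simps)
      qed
      then have "convergent (\<lambda>k. g (r k) \<theta>)" by (rule fast_Cauchy_convergent)
      then show ?thesis by (simp add: convergent_LIMSEQ_iff)
    qed auto
  qed
  then show ?thesis by (rule that[OF r, rotated]) measurable
qed

text \<open>
  The midpoint of two near-minimizers is again feasible, so its error cannot fall below \<open>d\<close>. Hence the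
  integrated convexity defect is small, and uniform convexity makes the two close. This one estimate
  yields both existence (a minimizing sequence is Cauchy) and uniqueness of the minimizer.
\<close>

lemma near_minimizers_close:
  assumes f: "spectral_density f" and \<alpha>: "1 < \<alpha>" and A: "A \<in> borel_measurable circle_measure"
    and d: "d < \<infinity>" "\<forall>h\<in>observed_space \<alpha> N f. d \<le> weighted_power_integral \<alpha> f (\<lambda>\<theta>. A \<theta> - h \<theta>)"
    and e: "(0::real) < e"
  shows "\<exists>\<eta>>0::real. \<forall>g\<in>observed_space \<alpha> N f. \<forall>h\<in>observed_space \<alpha> N f.
       weighted_power_integral \<alpha> f (\<lambda>\<theta>. A \<theta> - g \<theta>) \<le> d + ennreal \<eta> \<longrightarrow>
       weighted_power_integral \<alpha> f (\<lambda>\<theta>. A \<theta> - h \<theta>) \<le> d + ennreal \<eta> \<longrightarrow>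
       weighted_power_integral \<alpha> f (\<lambda>\<theta>. g \<theta> - h \<theta>) < ennreal e"
proof -
  obtain D where D: "d = ennreal D" "0 \<le> D" using d(1) by (cases d) auto
  \<comment> \<open>The convexity inequality will bound the distance by \<open>2 \<epsilon> (D + \<eta>) + M \<eta>\<close>; the choices
    make the summands at most \<open>e / 2\<close> and \<open>e / 4\<close>.\<close>
  define \<epsilon> where "\<epsilon> = e / (4 * (D + 1))"
  have \<epsilon>: "0 < \<epsilon>" using D e by (simp add: \<epsilon>_def)
  obtain M where M: "0 \<le> M" and ineq: "\<And>a b. cmod (a - b) powr \<alpha> + M * cmod ((a + b) / 2) powr \<alpha>
      \<le> \<epsilon> * (cmod a powr \<alpha> + cmod b powr \<alpha>) + M * ((cmod a powr \<alpha> + cmod b powr \<alpha>) / 2)"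
    using cmod_powr_uniform_convexity[OF \<alpha> \<epsilon>] by blast
  define \<eta> where "\<eta> = min 1 (e / (4 * (M + 1)))"
  have \<eta>: "0 < \<eta>" "\<eta> \<le> 1" "\<eta> \<le> e / (4 * (M + 1))" using M e by (auto simp: \<eta>_def)
  have "M * \<eta> \<le> M * (e / (4 * (M + 1)))" using M \<eta> by (intro mult_left_mono)
  also have "\<dots> \<le> e / 4" using M e by (simp add: field_simps)
  finally have M\<eta>: "M * \<eta> \<le> e / 4" .
  have "2 * \<epsilon> * (D + \<eta>) \<le> 2 * \<epsilon> * (D + 1)" using \<epsilon> \<eta> by (intro mult_left_mono) auto
  also have "\<dots> = e / 2" using D by (simp add: \<epsilon>_def field_simps)
  finally have \<epsilon>D: "2 * \<epsilon> * (D + \<eta>) \<le> e / 2" .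
  show ?thesis
  proof (intro exI[of _ \<eta>] conjI \<eta>(1) ballI impI)
    fix g h
    assume g: "g \<in> observed_space \<alpha> N f" and h: "h \<in> observed_space \<alpha> N f"
      and Wg: "weighted_power_integral \<alpha> f (\<lambda>\<theta>. A \<theta> - g \<theta>) \<le> d + ennreal \<eta>"
      and Wh: "weighted_power_integral \<alpha> f (\<lambda>\<theta>. A \<theta> - h \<theta>) \<le> d + ennreal \<eta>"
    note [measurable] = A observed_space_measurable[OF g] observed_space_measurable[OF h]
    define W where "W = weighted_power_integral \<alpha> f (\<lambda>\<theta>. g \<theta> - h \<theta>)"
    have "ennreal 1 * weighted_power_integral \<alpha> f (\<lambda>\<theta>. g \<theta> - h \<theta>)
        + ennreal M * weighted_power_integral \<alpha> f (\<lambda>\<theta>. A \<theta> - (g \<theta> + h \<theta>) / 2)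
       \<le> ennreal (\<epsilon> + M / 2) * weighted_power_integral \<alpha> f (\<lambda>\<theta>. A \<theta> - g \<theta>)
        + ennreal (\<epsilon> + M / 2) * weighted_power_integral \<alpha> f (\<lambda>\<theta>. A \<theta> - h \<theta>)"
    proof (rule weighted_power_integral_combine[OF f])
      fix \<theta>
      have "cmod (g \<theta> - h \<theta>) = cmod ((A \<theta> - g \<theta>) - (A \<theta> - h \<theta>))"
        by (simp add: norm_minus_commute)
      moreover have "A \<theta> - (g \<theta> + h \<theta>) / 2 = ((A \<theta> - g \<theta>) + (A \<theta> - h \<theta>)) / 2" by (simp add: field_simps)
      ultimately show "1 * cmod (g \<theta> - h \<theta>) powr \<alpha> + M * cmod (A \<theta> - (g \<theta> + h \<theta>) / 2) powr \<alpha>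
          \<le> (\<epsilon> + M / 2) * cmod (A \<theta> - g \<theta>) powr \<alpha> + (\<epsilon> + M / 2) * cmod (A \<theta> - h \<theta>) powr \<alpha>"
        using ineq[of "A \<theta> - g \<theta>" "A \<theta> - h \<theta>"] by (simp only:) (simp add: field_simps)
    qed (use \<epsilon> M in auto)
    moreover have "ennreal M * d \<le> ennreal M * weighted_power_integral \<alpha> f (\<lambda>\<theta>. A \<theta> - (g \<theta> + h \<theta>) / 2)"
      using d(2)[rule_format, OF observed_space_midpoint[OF f _ g h]] \<alpha> by (intro mult_left_mono) auto
    moreover have "ennreal (\<epsilon> + M / 2) * weighted_power_integral \<alpha> f (\<lambda>\<theta>. A \<theta> - g \<theta>)
        + ennreal (\<epsilon> + M / 2) * weighted_power_integral \<alpha> f (\<lambda>\<theta>. A \<theta> - h \<theta>)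
        \<le> ennreal (\<epsilon> + M / 2) * (d + ennreal \<eta>) + ennreal (\<epsilon> + M / 2) * (d + ennreal \<eta>)"
      using Wg Wh by (intro add_mono mult_left_mono) auto
    ultimately have le: "W + ennreal M * d
        \<le> ennreal (\<epsilon> + M / 2) * (d + ennreal \<eta>) + ennreal (\<epsilon> + M / 2) * (d + ennreal \<eta>)"
      unfolding W_def[symmetric] by (auto intro: order_trans[OF add_left_mono] order_trans)
    also have "\<dots> = ennreal ((\<epsilon> + M / 2) * (D + \<eta>) + (\<epsilon> + M / 2) * (D + \<eta>))"
      using D \<epsilon> M \<eta> by (simp add: ennreal_plus[symmetric] ennreal_mult'[symmetric] del: ennreal_plus)
    finally have le': "W + ennreal (M * D) \<le> ennreal ((\<epsilon> + M / 2) * (D + \<eta>) + (\<epsilon> + M / 2) * (D + \<eta>))"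
      using D M by (simp add: ennreal_mult')
    then have "W < \<infinity>" by (auto simp: less_top[symmetric] top_unique)
    then obtain w where w: "W = ennreal w" "0 \<le> w" by (cases W) auto
    have "w + M * D \<le> (\<epsilon> + M / 2) * (D + \<eta>) + (\<epsilon> + M / 2) * (D + \<eta>)"
      using le' D M \<epsilon> \<eta> w by (simp add: ennreal_plus[symmetric] del: ennreal_plus)
    then have "w \<le> 2 * \<epsilon> * (D + \<eta>) + M * \<eta>" by (simp add: algebra_simps)
    also have "\<dots> < e" using \<epsilon>D M\<eta> e by linarith
    finally show "weighted_power_integral \<alpha> f (\<lambda>\<theta>. g \<theta> - h \<theta>) < ennreal e"
      using w by (simp add: W_def[symmetric] ennreal_lessI)
  qed
qed

text \<open>
  Existence matters for every density of the class and not only for the least favorable one: the optimal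
  error is defined by a choice operator, which says nothing unless a minimizer exists.
\<close>

lemma observed_space_minimizer_exists:
  assumes f: "spectral_density f" and \<alpha>: "1 < \<alpha>" and A: "A \<in> L_space \<alpha> f"
  obtains h where "is_arg_min (\<lambda>h. weighted_power_integral \<alpha> f (\<lambda>\<theta>. A \<theta> - h \<theta>))
                              (\<lambda>h. h \<in> observed_space \<alpha> N f) h"
proof -
  have \<alpha>0: "0 \<le> \<alpha>" "0 < \<alpha>" using \<alpha> by auto
  define W where "W h = weighted_power_integral \<alpha> f (\<lambda>\<theta>. A \<theta> - h \<theta>)" for h
  define d where "d = (INF h\<in>observed_space \<alpha> N f. W h)"
  have dW: "d \<le> W h" if "h \<in> observed_space \<alpha> N f" for h
    unfolding d_def using that by (rule INF_lower)
  have Am: "A \<in> borel_measurable circle_measure" using A by (simp add: L_space_iff)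
  have "d \<le> W (\<lambda>_. 0)" by (rule dW) (rule zero_in_observed_space[OF f \<alpha>0(1)])
  also have "\<dots> < \<infinity>" using A by (simp add: W_def L_space_iff)
  finally have dfin: "d < \<infinity>" .
  have "\<exists>h\<in>observed_space \<alpha> N f. W h < d + ennreal (1 / Suc n)" for n
  proof -
    have "d < d + ennreal (1 / Suc n)" using dfin by (simp add: ennreal_add_left_cancel_less)
    then show ?thesis unfolding d_def by (simp add: INF_less_iff)
  qed
  then obtain h where h: "\<And>n. h n \<in> observed_space \<alpha> N f" "\<And>n. W (h n) < d + ennreal (1 / Suc n)"
    by metis
  have Cauchy: "\<exists>n0. \<forall>m\<ge>n0. \<forall>n\<ge>n0. weighted_power_integral \<alpha> f (\<lambda>\<theta>. h m \<theta> - h n \<theta>) < ennreal e"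
    if e: "0 < e" for e :: real
  proof -
    obtain \<eta> where \<eta>: "0 < \<eta>" and close:
      "\<forall>g\<in>observed_space \<alpha> N f. \<forall>h\<in>observed_space \<alpha> N f.
         W g \<le> d + ennreal \<eta> \<longrightarrow> W h \<le> d + ennreal \<eta> \<longrightarrow>
         weighted_power_integral \<alpha> f (\<lambda>\<theta>. g \<theta> - h \<theta>) < ennreal e"
      using near_minimizers_close[OF f \<alpha> Am dfin _ e] dW unfolding W_def by blast
    obtain n0 where n0: "1 / Suc n0 < \<eta>" using \<eta> nat_approx_posE by blast
    have "W (h n) \<le> d + ennreal \<eta>" if "n \<ge> n0" for n
    proof -
      have "1 / Suc n \<le> 1 / Suc n0" using that by (simp add: frac_le)
      then have "1 / Suc n \<le> \<eta>" using n0 by linarith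
      then have "d + ennreal (1 / Suc n) \<le> d + ennreal \<eta>" by (intro add_left_mono ennreal_leI)
      then show ?thesis using h(2)[of n] by (meson less_imp_le order_trans)
    qed
    then show ?thesis using close h(1) by blast
  qed
  have hm: "h n \<in> borel_measurable circle_measure" for n
    using observed_space_measurable[OF h(1)] .
  obtain r G where r: "strict_mono r" and G: "G \<in> borel_measurable circle_measure"
    and lim: "AE \<theta> in circle_measure. f \<theta> = 0 \<or> (\<lambda>k. h (r k) \<theta>) \<longlonglongrightarrow> G \<theta>"
    using weighted_Cauchy_subsequence[where g = h, OF f \<alpha>0(2) hm Cauchy] by blast
  note [measurable] = Am hm G
  have G_in: "G \<in> observed_space \<alpha> N f"
  proof (rule observed_space_closed[OF f \<alpha>0(1) G])
    fix e :: real assume e: "0 < e"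
    then obtain n0 where n0: "\<And>m n. m \<ge> n0 \<Longrightarrow> n \<ge> n0 \<Longrightarrow>
        weighted_power_integral \<alpha> f (\<lambda>\<theta>. h m \<theta> - h n \<theta>) < ennreal (e / 2)"
      using Cauchy[of "e / 2"] by auto
    have "weighted_power_integral \<alpha> f (\<lambda>\<theta>. G \<theta> - h n0 \<theta>)
        \<le> liminf (\<lambda>k. weighted_power_integral \<alpha> f (\<lambda>\<theta>. h (r k) \<theta> - h n0 \<theta>))"
    proof (rule weighted_power_integral_le_liminf[OF spectral_densityD(1)[OF f] \<alpha>0(2)])
      show "AE \<theta> in circle_measure. f \<theta> = 0 \<or> (\<lambda>k. h (r k) \<theta> - h n0 \<theta>) \<longlonglongrightarrow> G \<theta> - h n0 \<theta>"
        using lim by eventually_elim (auto intro: tendsto_diff)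
    qed measurable
    also have "\<dots> \<le> ennreal (e / 2)"
    proof (rule Liminf_le)
      have "weighted_power_integral \<alpha> f (\<lambda>\<theta>. h (r k) \<theta> - h n0 \<theta>) \<le> ennreal (e / 2)" if "n0 \<le> k" for k
        using n0[of "r k" n0] le_trans[OF that seq_suble[OF r]] by (simp add: less_imp_le)
      then show "\<forall>\<^sub>F k in sequentially. weighted_power_integral \<alpha> f (\<lambda>\<theta>. h (r k) \<theta> - h n0 \<theta>) \<le> ennreal (e / 2)"
        using eventually_sequentially by blast
    qed simp
    also have "\<dots> < ennreal e" using e by (simp add: ennreal_lessI)
    finally show "\<exists>g\<in>observed_space \<alpha> N f. weighted_power_integral \<alpha> f (\<lambda>\<theta>. G \<theta> - g \<theta>) < ennreal e"
      using h(1) by blast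
  qed
  have "W G \<le> liminf (\<lambda>k. W (h (r k)))"
    unfolding W_def
  proof (rule weighted_power_integral_le_liminf[OF spectral_densityD(1)[OF f] \<alpha>0(2)])
    show "AE \<theta> in circle_measure. f \<theta> = 0 \<or> (\<lambda>k. A \<theta> - h (r k) \<theta>) \<longlonglongrightarrow> A \<theta> - G \<theta>"
      using lim by eventually_elim (auto intro: tendsto_diff)
  qed measurable
  also have "\<dots> \<le> liminf (\<lambda>k. d + ennreal (1 / Suc k))"
  proof (rule Liminf_mono, rule always_eventually, rule allI)
    fix k
    have "k \<le> r k" by (rule seq_suble[OF r])
    then have "1 / real (Suc (r k)) \<le> 1 / real (Suc k)" by (simp add: frac_le)
    then have "d + ennreal (1 / Suc (r k)) \<le> d + ennreal (1 / Suc k)" by (intro add_left_mono ennreal_leI)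
    then show "W (h (r k)) \<le> d + ennreal (1 / Suc k)"
      using h(2)[of "r k"] by (meson less_imp_le order_trans)
  qed
  also have "\<dots> = d"
  proof -
    have "(\<lambda>k. d + ennreal (1 / Suc k)) \<longlonglongrightarrow> d + ennreal 0"
      by (intro tendsto_add tendsto_const tendsto_ennrealI LIMSEQ_inverse_real_of_nat[unfolded inverse_eq_divide])
    then show ?thesis by (simp add: lim_imp_Liminf)
  qed
  finally have "W G \<le> d" .
  then have "\<not> W g < W G" if "g \<in> observed_space \<alpha> N f" for g
    using dW[OF that] by (meson not_le order_trans)
  then have "is_arg_min W (\<lambda>h. h \<in> observed_space \<alpha> N f) G"
    using G_in by (auto simp: is_arg_min_def)
  then show ?thesis using that unfolding W_def by blast
qed

text \<open>
  A minimum with respect to \<open>f d\<theta>\<close> determines the function only \<open>f d\<theta>\<close>-almost everywhere;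
  positivity of \<open>f\<close> turns this into Lebesgue-almost everywhere.
\<close>

lemma observed_space_minimizer_unique:
  assumes f: "spectral_density f" and \<alpha>: "1 < \<alpha>" and A: "A \<in> L_space \<alpha> f"
    and pos: "AE \<theta> in circle_measure. 0 < f \<theta>"
    and g: "is_arg_min (\<lambda>h. weighted_power_integral \<alpha> f (\<lambda>\<theta>. A \<theta> - h \<theta>)) (\<lambda>h. h \<in> observed_space \<alpha> N f) g"
    and h: "is_arg_min (\<lambda>h. weighted_power_integral \<alpha> f (\<lambda>\<theta>. A \<theta> - h \<theta>)) (\<lambda>h. h \<in> observed_space \<alpha> N f) h"
  shows "AE \<theta> in circle_measure. g \<theta> = h \<theta>"
proof -
  have \<alpha>0: "0 \<le> \<alpha>" using \<alpha> by auto
  define d where "d = weighted_power_integral \<alpha> f (\<lambda>\<theta>. A \<theta> - g \<theta>)"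
  have gin: "g \<in> observed_space \<alpha> N f" and hin: "h \<in> observed_space \<alpha> N f"
    using g h by (auto simp: is_arg_min_def)
  have dmin: "d \<le> weighted_power_integral \<alpha> f (\<lambda>\<theta>. A \<theta> - k \<theta>)" if "k \<in> observed_space \<alpha> N f" for k
    using g that by (auto simp: is_arg_min_def d_def not_less)
  have dh: "d = weighted_power_integral \<alpha> f (\<lambda>\<theta>. A \<theta> - h \<theta>)"
    using h gin dmin[OF hin] by (intro antisym) (auto simp: is_arg_min_def d_def not_less)
  have dfin: "d < \<infinity>"
    using dmin[OF zero_in_observed_space[OF f \<alpha>0]] A by (auto simp: L_space_iff intro: le_less_trans)
  have Am: "A \<in> borel_measurable circle_measure" using A by (simp add: L_space_iff)
  have "weighted_power_integral \<alpha> f (\<lambda>\<theta>. g \<theta> - h \<theta>) < ennreal e" if e: "0 < e" for e :: real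
  proof -
    obtain \<eta> where close: "0 < \<eta>"
      "\<forall>g\<in>observed_space \<alpha> N f. \<forall>h\<in>observed_space \<alpha> N f.
       weighted_power_integral \<alpha> f (\<lambda>\<theta>. A \<theta> - g \<theta>) \<le> d + ennreal \<eta> \<longrightarrow>
       weighted_power_integral \<alpha> f (\<lambda>\<theta>. A \<theta> - h \<theta>) \<le> d + ennreal \<eta> \<longrightarrow>
       weighted_power_integral \<alpha> f (\<lambda>\<theta>. g \<theta> - h \<theta>) < ennreal e"
      using near_minimizers_close[OF f \<alpha> Am dfin _ e] dmin by blast
    show ?thesis
      by (rule close(2)[rule_format, OF gin hin]) (simp_all add: dh[symmetric] d_def[symmetric])
  qed
  note small = this
  have "weighted_power_integral \<alpha> f (\<lambda>\<theta>. g \<theta> - h \<theta>) \<le> 0"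
  proof (rule ennreal_le_epsilon)
    fix e :: real assume "0 < e"
    from small[OF this]
    show "weighted_power_integral \<alpha> f (\<lambda>\<theta>. g \<theta> - h \<theta>) \<le> 0 + ennreal e"
      by (simp add: less_imp_le)
  qed
  then have W0: "weighted_power_integral \<alpha> f (\<lambda>\<theta>. g \<theta> - h \<theta>) = 0" by simp
  note [measurable] = observed_space_measurable[OF gin] observed_space_measurable[OF hin]
    spectral_densityD(1)[OF f]
  have "(\<lambda>\<theta>. ennreal (cmod (g \<theta> - h \<theta>) powr \<alpha> * f \<theta>)) \<in> borel_measurable circle_measure"
    by measurable
  from nn_integral_0_iff_AE[OF this] W0
  have "AE \<theta> in circle_measure. ennreal (cmod (g \<theta> - h \<theta>) powr \<alpha> * f \<theta>) = 0"
    unfolding weighted_power_integral_def by blast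
  with pos show ?thesis
  proof eventually_elim
    case (elim \<theta>)
    then have "cmod (g \<theta> - h \<theta>) powr \<alpha> * f \<theta> \<le> 0" by (simp add: ennreal_eq_0_iff)
    then show ?case using elim(1) by (simp add: mult_le_0_iff)
  qed
qed

section \<open>Trigonometric polynomials and bounded functions\<close>

lemma bounded_integrable_circle:
  fixes g :: "real \<Rightarrow> 'b::{banach, second_countable_topology}"
  assumes g: "g \<in> borel_measurable circle_measure"
    and B: "AE \<theta> in circle_measure. norm (g \<theta>) \<le> B"
  shows "integrable circle_measure g"
proof -
  interpret finite_measure circle_measure by (rule finite_measure_lebesgue_on) auto
  show ?thesis using g B by (rule integrable_const_bound[rotated])
qed

lemma integral_cis_circle:
  fixes m :: int
  assumes "m \<noteq> 0"
  shows "(\<integral>\<theta>. cis (of_int m * \<theta>) \<partial>circle_measure) = 0"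
proof -
  have meas: "(\<lambda>\<theta>. cis (of_int m * \<theta>)) \<in> borel_measurable circle_measure"
    by (intro continuous_on_measurable_circle continuous_intros)
  define F where "F \<theta> = cis (of_int m * \<theta>) / (\<i> * of_int m)" for \<theta> :: real
  have "((\<lambda>\<theta>. cis (of_int m * \<theta>)) has_integral (F pi - F (-pi))) {-pi..pi}"
  proof (rule fundamental_theorem_of_calculus)
    fix \<theta> :: real
    have "(F has_vector_derivative (of_int m * (\<i> * cis (of_int m * \<theta>))) / (\<i> * of_int m)) (at \<theta> within {-pi..pi})"
      unfolding F_def cis_conv_exp
      by (rule derivative_eq_intros has_vector_derivative_real_field refl | simp add: algebra_simps)+
    then show "(F has_vector_derivative cis (of_int m * \<theta>)) (at \<theta> within {-pi..pi})"
      using assms by simp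
  qed simp
  moreover have "F pi = F (-pi)"
  proof -
    have "sin (of_int m * pi) = 0" using sin_zero_iff_int2 by blast
    then have "cis (of_int m * pi) = cis (- (of_int m * pi))" by (simp add: complex_eq_iff)
    then show ?thesis by (simp add: F_def)
  qed
  ultimately have "integral {-pi..pi} (\<lambda>\<theta>. cis (of_int m * \<theta>)) = 0"
    by (simp add: integral_unique)
  moreover have "integrable circle_measure (\<lambda>\<theta>. cis (of_int m * \<theta>))"
    by (rule bounded_integrable_circle[OF meas, of 1]) simp
  ultimately show ?thesis by (subst lebesgue_integral_eq_integral) auto
qed

text \<open>
  An inductive presentation makes closure under products and the computation of Fourier coefficients
  plain inductions, without bookkeeping of frequency sets.
\<close>

inductive_set trigonometric_polynomials :: "(real \<Rightarrow> complex) set" where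
  monomial: "(\<lambda>\<theta>. c * cis (of_int k * \<theta>)) \<in> trigonometric_polynomials"
| add: "p \<in> trigonometric_polynomials \<Longrightarrow> q \<in> trigonometric_polynomials
    \<Longrightarrow> (\<lambda>\<theta>. p \<theta> + q \<theta>) \<in> trigonometric_polynomials"

lemma trigonometric_polynomials_const: "(\<lambda>_. c) \<in> trigonometric_polynomials"
  using trigonometric_polynomials.monomial[of c 0] by simp

lemma trigonometric_polynomials_mult:
  assumes "p \<in> trigonometric_polynomials" "q \<in> trigonometric_polynomials"
  shows "(\<lambda>\<theta>. p \<theta> * q \<theta>) \<in> trigonometric_polynomials"
  using assms(1)
proof induction
  case (monomial c k)
  show ?case using assms(2)
  proof induction
    case (monomial d l)
    have "(\<lambda>\<theta>. c * cis (of_int k * \<theta>) * (d * cis (of_int l * \<theta>))) = (\<lambda>\<theta>. (c * d) * cis (of_int (k + l) * \<theta>))"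
      by (auto simp: cis_mult[symmetric] algebra_simps)
    then show ?case by (simp only: trigonometric_polynomials.monomial)
  next
    case (add p q)
    then show ?case using trigonometric_polynomials.add by (simp add: distrib_left)
  qed
next
  case (add p q)
  then show ?case using trigonometric_polynomials.add by (simp add: distrib_right)
qed

lemma trigonometric_polynomials_continuous:
  "p \<in> trigonometric_polynomials \<Longrightarrow> continuous_on UNIV p"
  by (induction rule: trigonometric_polynomials.induct) (auto intro!: continuous_intros)

lemma trigonometric_polynomials_measurable:
  "p \<in> trigonometric_polynomials \<Longrightarrow> p \<in> borel_measurable circle_measure"
  by (intro continuous_on_measurable_circle trigonometric_polynomials_continuous)

lemma trigonometric_polynomials_integrable:
  assumes "p \<in> trigonometric_polynomials"
  shows "integrable circle_measure p"
proof -
  have "\<exists>B. \<forall>\<theta>. cmod (p \<theta>) \<le> B"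
    using assms
  proof induction
    case (monomial c k)
    then show ?case by (auto simp: norm_mult)
  next
    case (add p q)
    then show ?case by (meson add_mono norm_triangle_le)
  qed
  then obtain B where "\<And>\<theta>. cmod (p \<theta>) \<le> B" by blast
  then show ?thesis
    by (intro bounded_integrable_circle[where B = B] trigonometric_polynomials_measurable assms) simp
qed

lemma real_polynomial_function_cis:
  assumes "real_polynomial_function P"
  shows "(\<lambda>\<theta>. complex_of_real (P (cis \<theta>))) \<in> trigonometric_polynomials"
  using assms
proof induction
  case (linear f)
  interpret bounded_linear f by fact
  define a b where "a = f 1" and "b = f \<i>"
  have "complex_of_real (f (cis \<theta>)) = (of_real a - \<i> * of_real b) / 2 * cis (of_int 1 * \<theta>)
          + (of_real a + \<i> * of_real b) / 2 * cis (of_int (-1) * \<theta>)" for \<theta>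
  proof -
    have "f (cis \<theta>) = f (cos \<theta> *\<^sub>R 1 + sin \<theta> *\<^sub>R \<i>)"
      by (rule arg_cong[of _ _ f]) (simp add: complex_eq_iff)
    also have "\<dots> = cos \<theta> * a + sin \<theta> * b" by (simp add: add scaleR a_def b_def)
    finally show ?thesis by (simp add: complex_eq_iff field_simps)
  qed
  then have "(\<lambda>\<theta>. complex_of_real (f (cis \<theta>))) = (\<lambda>\<theta>. (of_real a - \<i> * of_real b) / 2 * cis (of_int 1 * \<theta>)
          + (of_real a + \<i> * of_real b) / 2 * cis (of_int (-1) * \<theta>))" by (rule ext)
  then show ?case
    by (simp only: trigonometric_polynomials.intros)
next
  case (const c)
  show ?case by (rule trigonometric_polynomials_const)
next
  case (add f g)
  then show ?case by (simp add: trigonometric_polynomials.add)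
next
  case (mult f g)
  then show ?case by (simp add: trigonometric_polynomials_mult)
qed

text \<open>
  Real polynomials in the coordinates of a point of the unit circle are trigonometric polynomials in its
  argument, so the Weierstrass theorem on a compact subset of the plane gives the trigonometric one.
\<close>

lemma trigonometric_approximation:
  fixes g :: "complex \<Rightarrow> complex"
  assumes g: "continuous_on (sphere 0 1) g" and e: "0 < e"
  obtains q where "q \<in> trigonometric_polynomials" "\<And>\<theta>. cmod (g (cis \<theta>) - q \<theta>) < e"
proof -
  have e2: "0 < e / 2" using e by simp
  have S: "compact (sphere 0 1 :: complex set)" by simp
  obtain P where P: "real_polynomial_function P" "\<And>z. z \<in> sphere 0 1 \<Longrightarrow> \<bar>Re (g z) - P z\<bar> < e / 2"
    using Stone_Weierstrass_real_polynomial_function[OF S continuous_on_Re[OF g] e2] by blast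
  obtain Q where Q: "real_polynomial_function Q" "\<And>z. z \<in> sphere 0 1 \<Longrightarrow> \<bar>Im (g z) - Q z\<bar> < e / 2"
    using Stone_Weierstrass_real_polynomial_function[OF S continuous_on_Im[OF g] e2] by blast
  define q where "q \<theta> = complex_of_real (P (cis \<theta>)) + \<i> * complex_of_real (Q (cis \<theta>))" for \<theta>
  have "q \<in> trigonometric_polynomials"
    unfolding q_def
    by (intro trigonometric_polynomials.add trigonometric_polynomials_mult trigonometric_polynomials_const
        real_polynomial_function_cis P Q)
  moreover have "cmod (g (cis \<theta>) - q \<theta>) < e" for \<theta>
  proof -
    have "cmod (g (cis \<theta>) - q \<theta>) \<le> \<bar>Re (g (cis \<theta>)) - P (cis \<theta>)\<bar> + \<bar>Im (g (cis \<theta>)) - Q (cis \<theta>)\<bar>"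
      using cmod_le[of "g (cis \<theta>) - q \<theta>"] by (simp add: q_def)
    also have "\<dots> < e" using P(2)[of "cis \<theta>"] Q(2)[of "cis \<theta>"] by simp
    finally show ?thesis .
  qed
  ultimately show ?thesis by (rule that)
qed

definition fourier_coefficient :: "(real \<Rightarrow> complex) \<Rightarrow> nat \<Rightarrow> complex" where
  "fourier_coefficient g k = (\<integral>\<theta>. cis (- real k * \<theta>) * g \<theta> \<partial>circle_measure) / of_real (2 * pi)"

lemma fourier_coefficient_monomial:
  "fourier_coefficient (\<lambda>\<theta>. c * cis (of_int j * \<theta>)) k = (if j = int k then c else 0)"
proof -
  have eq: "cis (- real k * \<theta>) * (c * cis (of_int j * \<theta>)) = c * cis (of_int (j - int k) * \<theta>)" for \<theta>
    by (simp add: cis_mult algebra_simps)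
  have "(\<integral>\<theta>. cis (- real k * \<theta>) * (c * cis (of_int j * \<theta>)) \<partial>circle_measure)
      = c * (\<integral>\<theta>. cis (of_int (j - int k) * \<theta>) \<partial>circle_measure)"
    unfolding eq by (rule integral_mult_right_zero)
  also have "\<dots> = (if j = int k then c * of_real (2 * pi) else 0)"
    using integral_cis_circle[of "j - int k"]
    by (auto simp: measure_restrict_space scaleR_conv_of_real)
  finally show ?thesis by (simp add: fourier_coefficient_def)
qed

lemma fourier_coefficient_add:
  assumes "integrable circle_measure p" "integrable circle_measure q"
  shows "fourier_coefficient (\<lambda>\<theta>. p \<theta> + q \<theta>) k = fourier_coefficient p k + fourier_coefficient q k"
proof -
  have "integrable circle_measure (\<lambda>\<theta>. cis (- real k * \<theta>) * g \<theta>)" if "integrable circle_measure g" for g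
  proof (rule Bochner_Integration.integrable_bound[OF that])
    have [measurable]: "(\<lambda>\<theta>. cis (- real k * \<theta>)) \<in> borel_measurable circle_measure"
      by (intro continuous_on_measurable_circle continuous_intros)
    note [measurable] = borel_measurable_integrable[OF that]
    show "(\<lambda>\<theta>. cis (- real k * \<theta>) * g \<theta>) \<in> borel_measurable circle_measure" by measurable
  qed (simp add: norm_mult)
  with assms show ?thesis
    by (simp add: fourier_coefficient_def distrib_left add_divide_distrib)
qed

text \<open>
  Writing the deleted terms with Fourier coefficients shows that the correction is small whenever these
  coefficients are. This is how a limit of trigonometric polynomials whose coefficients with index in
  \<open>{0, \<dots>, N}\<close> vanish is approximated from the observed span.
\<close>

lemma remove_unobserved_frequencies:
  assumes "q \<in> trigonometric_polynomials"
  shows "(\<lambda>\<theta>. q \<theta> - (\<Sum>k=0..N. fourier_coefficient q k * cis (real k * \<theta>))) \<in> observed_span N"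
  using assms
proof induction
  case (monomial c j)
  show ?case
  proof (cases "j \<in> {0..int N}")
    case True
    then obtain k0 where k0: "j = int k0" "k0 \<le> N" by (metis atLeastAtMost_iff nonneg_int_cases of_nat_le_iff)
    have "(\<Sum>k=0..N. fourier_coefficient (\<lambda>\<theta>. c * cis (of_int j * \<theta>)) k * cis (real k * \<theta>))
        = c * cis (of_int j * \<theta>)" for \<theta>
    proof -
      have "(\<Sum>k=0..N. fourier_coefficient (\<lambda>\<theta>. c * cis (of_int j * \<theta>)) k * cis (real k * \<theta>))
          = (\<Sum>k=0..N. if k = k0 then c * cis (real k * \<theta>) else 0)"
        unfolding fourier_coefficient_monomial using k0 by (intro sum.cong) auto
      also have "\<dots> = c * cis (of_int j * \<theta>)" using k0 by simp
      finally show ?thesis .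
    qed
    then show ?thesis using observed_spanI[of "{}" N] by simp
  next
    case False
    then have "(\<Sum>k=0..N. fourier_coefficient (\<lambda>\<theta>. c * cis (of_int j * \<theta>)) k * cis (real k * \<theta>)) = 0" for \<theta>
      unfolding fourier_coefficient_monomial by (intro sum.neutral) auto
    then show ?thesis using False observed_spanI[of "{j}" N "\<lambda>_. c"] by simp
  qed
next
  case (add p q)
  then show ?case
    using observed_span_add[OF add.IH]
    by (simp add: fourier_coefficient_add trigonometric_polynomials_integrable distrib_right sum.distrib algebra_simps)
qed

text \<open>
  Membership in the observed space for all densities at once. Boundedness is what makes it uniform in
  \<open>f\<close>: the Fourier coefficients of \<open>q n\<close> with index in \<open>{0, \<dots>, N}\<close> tend to those of \<open>g\<close>, which vanish,
  so removing the corresponding terms changes neither the limit nor the boundedness, and dominated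
  convergence applies to \<open>f d\<theta>\<close> with any integrable \<open>f\<close>.
\<close>

lemma bounded_limit_in_observed_space:
  assumes f: "spectral_density f" and \<alpha>: "0 < \<alpha>"
    and g: "g \<in> borel_measurable circle_measure"
    and q: "\<And>n. q n \<in> trigonometric_polynomials"
    and B: "\<And>n \<theta>. \<theta> \<in> {-pi..pi} \<Longrightarrow> cmod (q n \<theta>) \<le> B"
    and lim: "AE \<theta> in circle_measure. (\<lambda>n. q n \<theta>) \<longlonglongrightarrow> g \<theta>"
    and zero: "\<And>k. k \<le> N \<Longrightarrow> fourier_coefficient g k = 0"
  shows "g \<in> observed_space \<alpha> N f"
proof (rule observed_space_closed[OF f less_imp_le[OF \<alpha>] g])
  define c where "c n k = fourier_coefficient (q n) k" for n k
  define r where "r n \<theta> = q n \<theta> - (\<Sum>k=0..N. c n k * cis (real k * \<theta>))" for n \<theta>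
  have r_in: "r n \<in> observed_span N" for n
    unfolding r_def c_def by (rule remove_unobserved_frequencies[OF q])
  have B0: "0 \<le> B" by (rule order_trans[OF norm_ge_zero B[of 0 0]]) simp
  have cis_meas [measurable]: "(\<lambda>\<theta>. cis (x * \<theta>)) \<in> borel_measurable circle_measure" for x
    by (intro continuous_on_measurable_circle continuous_intros)
  have [measurable]: "q n \<in> borel_measurable circle_measure" for n
    by (rule trigonometric_polynomials_measurable[OF q])
  note [measurable] = g spectral_densityD(1)[OF f]
    continuous_on_measurable_circle[OF observed_span_continuous[OF r_in]]
  have inS: "AE \<theta> in circle_measure. \<theta> \<in> {-pi..pi}"
    using AE_space[of circle_measure] by simp
  have const_int: "integrable circle_measure (\<lambda>_. B)"
    by (rule bounded_integrable_circle[where B = B]) (use B0 in auto)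
  have c_lim: "(\<lambda>n. c n k) \<longlonglongrightarrow> 0" if k: "k \<le> N" for k
  proof -
    have "(\<lambda>n. \<integral>\<theta>. cis (- real k * \<theta>) * q n \<theta> \<partial>circle_measure)
        \<longlonglongrightarrow> (\<integral>\<theta>. cis (- real k * \<theta>) * g \<theta> \<partial>circle_measure)"
    proof (rule integral_dominated_convergence[where w = "\<lambda>_. B"])
      show "AE \<theta> in circle_measure. (\<lambda>n. cis (- real k * \<theta>) * q n \<theta>) \<longlonglongrightarrow> cis (- real k * \<theta>) * g \<theta>"
        using lim by eventually_elim (intro tendsto_mult tendsto_const)
      show "AE \<theta> in circle_measure. norm (cis (- real k * \<theta>) * q n \<theta>) \<le> B" for n
        using inS by eventually_elim (simp add: norm_mult B)
    qed (use const_int in measurable)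
    then have "(\<lambda>n. c n k) \<longlonglongrightarrow> fourier_coefficient g k"
      unfolding c_def fourier_coefficient_def by (intro tendsto_divide tendsto_const) auto
    then show ?thesis using zero[OF k] by simp
  qed
  have c_bound: "cmod (c n k) \<le> B" for n k
  proof -
    have "cmod (\<integral>\<theta>. cis (- real k * \<theta>) * q n \<theta> \<partial>circle_measure)
        \<le> (\<integral>\<theta>. cmod (cis (- real k * \<theta>) * q n \<theta>) \<partial>circle_measure)"
      by (rule integral_norm_bound)
    also have "\<dots> \<le> (\<integral>\<theta>. B \<partial>circle_measure)"
    proof (rule integral_mono_AE[OF _ const_int])
      show "AE \<theta> in circle_measure. cmod (cis (- real k * \<theta>) * q n \<theta>) \<le> B"
        using inS by eventually_elim (simp add: norm_mult B)
      moreover have "(\<lambda>\<theta>. cis (- real k * \<theta>) * q n \<theta>) \<in> borel_measurable circle_measure"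
        by measurable
      ultimately show "integrable circle_measure (\<lambda>\<theta>. cmod (cis (- real k * \<theta>) * q n \<theta>))"
        by (intro integrable_norm bounded_integrable_circle[where B = B])
    qed
    also have "\<dots> = 2 * pi * B" by (simp add: measure_restrict_space)
    finally show ?thesis by (simp add: c_def fourier_coefficient_def norm_divide norm_mult field_simps)
  qed
  define B' where "B' = B + (B + (real N + 1) * B)"
  have r_bound: "cmod (r n \<theta>) \<le> B + (real N + 1) * B" if \<theta>: "\<theta> \<in> {-pi..pi}" for n \<theta>
  proof -
    have "cmod (\<Sum>k=0..N. c n k * cis (real k * \<theta>)) \<le> (\<Sum>k=0..N. B)"
      by (rule sum_norm_le) (simp add: norm_mult c_bound)
    then have "cmod (\<Sum>k=0..N. c n k * cis (real k * \<theta>)) \<le> (real N + 1) * B" by (simp add: algebra_simps)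
    then show ?thesis unfolding r_def
      using norm_triangle_ineq4[of "q n \<theta>" "\<Sum>k=0..N. c n k * cis (real k * \<theta>)"] B[OF \<theta>, of n] by linarith
  qed
  have g_bound: "AE \<theta> in circle_measure. cmod (g \<theta>) \<le> B"
    using lim inS
  proof eventually_elim
    case (elim \<theta>)
    show ?case
      by (rule LIMSEQ_le_const2[OF tendsto_norm[OF elim(1)]]) (use B[OF elim(2)] in auto)
  qed
  have "(\<lambda>n. \<integral>\<^sup>+\<theta>. ennreal (cmod (g \<theta> - r n \<theta>) powr \<alpha> * f \<theta>) \<partial>circle_measure)
      \<longlonglongrightarrow> (\<integral>\<^sup>+\<theta>. 0 \<partial>circle_measure)"
  proof (rule nn_integral_dominated_convergence[where w = "\<lambda>\<theta>. ennreal (B' powr \<alpha> * f \<theta>)"])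
    show "AE \<theta> in circle_measure. ennreal (cmod (g \<theta> - r n \<theta>) powr \<alpha> * f \<theta>) \<le> ennreal (B' powr \<alpha> * f \<theta>)" for n
      using g_bound inS
    proof eventually_elim
      case (elim \<theta>)
      have "cmod (g \<theta> - r n \<theta>) \<le> B'"
        using norm_triangle_ineq4[of "g \<theta>" "r n \<theta>"] r_bound[OF elim(2), of n] elim(1)
        unfolding B'_def by linarith
      then show ?case
        using \<alpha> spectral_densityD(3)[OF f elim(2)]
        by (intro ennreal_leI mult_right_mono powr_mono2) auto
    qed
    show "AE \<theta> in circle_measure. (\<lambda>n. ennreal (cmod (g \<theta> - r n \<theta>) powr \<alpha> * f \<theta>)) \<longlonglongrightarrow> 0"
      using lim
    proof eventually_elim
      case (elim \<theta>)
      have "(\<lambda>n. r n \<theta>) \<longlonglongrightarrow> g \<theta> - (\<Sum>k=0..N. 0 * cis (real k * \<theta>))"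
        unfolding r_def by (intro tendsto_diff tendsto_sum tendsto_mult tendsto_const elim c_lim) auto
      then have "(\<lambda>n. g \<theta> - r n \<theta>) \<longlonglongrightarrow> g \<theta> - g \<theta>" by (intro tendsto_diff tendsto_const) simp
      then have "(\<lambda>n. ennreal (cmod (g \<theta> - r n \<theta>) powr \<alpha> * f \<theta>)) \<longlonglongrightarrow> ennreal (cmod (g \<theta> - g \<theta>) powr \<alpha> * f \<theta>)"
        using \<alpha> by (intro tendsto_ennrealI tendsto_mult tendsto_powr' tendsto_norm tendsto_const) auto
      then show ?case by simp
    qed
    have "integrable circle_measure (\<lambda>\<theta>. B' powr \<alpha> * f \<theta>)"
      using spectral_densityD(2)[OF f] by simp
    then have "(\<integral>\<^sup>+\<theta>. ennreal (norm (B' powr \<alpha> * f \<theta>)) \<partial>circle_measure) < \<infinity>"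
      unfolding integrable_iff_bounded by blast
    moreover have "(\<integral>\<^sup>+\<theta>. ennreal (norm (B' powr \<alpha> * f \<theta>)) \<partial>circle_measure)
       = (\<integral>\<^sup>+\<theta>. ennreal (B' powr \<alpha> * f \<theta>) \<partial>circle_measure)"
      using spectral_densityD(3)[OF f] by (intro nn_integral_cong) auto
    ultimately show "(\<integral>\<^sup>+\<theta>. ennreal (B' powr \<alpha> * f \<theta>) \<partial>circle_measure) < \<infinity>" by simp
  qed measurable
  then have W_lim: "(\<lambda>n. weighted_power_integral \<alpha> f (\<lambda>\<theta>. g \<theta> - r n \<theta>)) \<longlonglongrightarrow> 0"
    by (simp add: weighted_power_integral_def)
  fix e :: real assume "0 < e"
  then have "\<forall>\<^sub>F n in sequentially. weighted_power_integral \<alpha> f (\<lambda>\<theta>. g \<theta> - r n \<theta>) < ennreal e"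
    by (intro order_tendstoD(2)[OF W_lim]) auto
  then obtain n where "weighted_power_integral \<alpha> f (\<lambda>\<theta>. g \<theta> - r n \<theta>) < ennreal e"
    by (auto simp: eventually_sequentially)
  then show "\<exists>h\<in>observed_space \<alpha> N f. weighted_power_integral \<alpha> f (\<lambda>\<theta>. g \<theta> - h \<theta>) < ennreal e"
    using observed_span_subset_space[OF f less_imp_le[OF \<alpha>] r_in] by blast
qed

section \<open>Duality and optimality\<close>

lemma L_space_power_integrable:
  assumes f: "spectral_density f" and v: "v \<in> L_space \<alpha> f"
  shows "integrable circle_measure (\<lambda>\<theta>. cmod (v \<theta>) powr \<alpha> * f \<theta>)"
    and "ennreal (\<integral>\<theta>. cmod (v \<theta>) powr \<alpha> * f \<theta> \<partial>circle_measure) = weighted_power_integral \<alpha> f v"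
proof -
  have [measurable]: "v \<in> borel_measurable circle_measure" using v by (simp add: L_space_iff)
  note [measurable] = spectral_densityD(1)[OF f]
  have nn: "AE \<theta> in circle_measure. 0 \<le> cmod (v \<theta>) powr \<alpha> * f \<theta>"
    using spectral_densityD(3)[OF f] by (intro AE_I2) auto
  show int: "integrable circle_measure (\<lambda>\<theta>. cmod (v \<theta>) powr \<alpha> * f \<theta>)"
    using v nn by (intro integrableI_nonneg) (auto simp: L_space_iff weighted_power_integral_def)
  show "ennreal (\<integral>\<theta>. cmod (v \<theta>) powr \<alpha> * f \<theta> \<partial>circle_measure) = weighted_power_integral \<alpha> f v"
    unfolding weighted_power_integral_def using nn_integral_eq_integral[OF int nn] by simp
qed

text \<open>
  Continuity of \<open>v \<mapsto> \<integral> v \<phi> d\<theta>\<close> on \<open>L\<^sup>\<alpha>(f d\<theta>)\<close> for \<open>|\<phi>| \<le> K f\<close>. It follows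
  by integrating the elementary bound \<open>|v| \<le> \<delta> + \<delta>\<^sup>1\<^sup>-\<^sup>\<alpha> |v|\<^sup>\<alpha>\<close> against \<open>f\<close>; choosing \<open>\<delta>\<^sup>\<alpha>\<close> of
  the size of the weighted integral of \<open>v\<close> makes both terms of order \<open>\<delta>\<close>.
\<close>

lemma L_space_pairing:
  assumes f: "spectral_density f" and \<alpha>: "1 < \<alpha>" and v: "v \<in> L_space \<alpha> f"
    and \<phi>: "\<phi> \<in> borel_measurable circle_measure"
    and K: "0 \<le> K" "AE \<theta> in circle_measure. cmod (\<phi> \<theta>) \<le> K * f \<theta>"
  shows "integrable circle_measure (\<lambda>\<theta>. v \<theta> * \<phi> \<theta>)"
    and "0 < \<delta> \<Longrightarrow> weighted_power_integral \<alpha> f v \<le> ennreal (\<delta> powr \<alpha>) \<Longrightarrow>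
      cmod (\<integral>\<theta>. v \<theta> * \<phi> \<theta> \<partial>circle_measure) \<le> \<delta> * (K * ((\<integral>\<theta>. f \<theta> \<partial>circle_measure) + 1))"
proof -
  have [measurable]: "v \<in> borel_measurable circle_measure" using v by (simp add: L_space_iff)
  note [measurable] = spectral_densityD(1)[OF f] \<phi>
  define w where "w \<delta> \<theta> = K * (\<delta> * f \<theta> + \<delta> powr (1 - \<alpha>) * (cmod (v \<theta>) powr \<alpha> * f \<theta>))" for \<delta> \<theta>
  have w_int: "integrable circle_measure (w \<delta>)" for \<delta>
    unfolding w_def using spectral_densityD(2)[OF f] L_space_power_integrable(1)[OF f v] by simp
  have inS: "AE \<theta> in circle_measure. \<theta> \<in> {-pi..pi}"
    using AE_space[of circle_measure] by simp
  have le: "AE \<theta> in circle_measure. cmod (v \<theta> * \<phi> \<theta>) \<le> w \<delta> \<theta>" if \<delta>: "0 < \<delta>" for \<delta>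
    using K(2) inS
  proof eventually_elim
    case (elim \<theta>)
    have f0: "0 \<le> f \<theta>" using spectral_densityD(3)[OF f elim(2)] .
    have "cmod (v \<theta>) \<le> \<delta> + \<delta> powr (1 - \<alpha>) * cmod (v \<theta>) powr \<alpha>"
    proof (cases "cmod (v \<theta>) \<le> \<delta>")
      case False
      then have "cmod (v \<theta>) = cmod (v \<theta>) powr (1 - \<alpha>) * cmod (v \<theta>) powr \<alpha>"
        using \<delta> by (simp add: powr_add[symmetric])
      also have "\<dots> \<le> \<delta> powr (1 - \<alpha>) * cmod (v \<theta>) powr \<alpha>"
        using False \<delta> \<alpha> by (intro mult_right_mono powr_mono2') auto
      finally show ?thesis using \<delta> by linarith
    qed (simp add: add_increasing2)
    then have "cmod (v \<theta>) * cmod (\<phi> \<theta>) \<le> (\<delta> + \<delta> powr (1 - \<alpha>) * cmod (v \<theta>) powr \<alpha>) * (K * f \<theta>)"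
      using elim(1) \<delta> by (intro mult_mono) auto
    then show ?case by (simp add: norm_mult w_def algebra_simps)
  qed
  show int: "integrable circle_measure (\<lambda>\<theta>. v \<theta> * \<phi> \<theta>)"
  proof (rule Bochner_Integration.integrable_bound[OF w_int[of 1]])
    show "AE \<theta> in circle_measure. norm (v \<theta> * \<phi> \<theta>) \<le> norm (w 1 \<theta>)"
      using le[OF zero_less_one] by eventually_elim auto
  qed measurable
  assume \<delta>: "0 < \<delta>" and W: "weighted_power_integral \<alpha> f v \<le> ennreal (\<delta> powr \<alpha>)"
  have I: "(\<integral>\<theta>. cmod (v \<theta>) powr \<alpha> * f \<theta> \<partial>circle_measure) \<le> \<delta> powr \<alpha>"
    using W unfolding L_space_power_integrable(2)[OF f v, symmetric] by (simp add: ennreal_le_iff)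
  have "cmod (\<integral>\<theta>. v \<theta> * \<phi> \<theta> \<partial>circle_measure) \<le> (\<integral>\<theta>. cmod (v \<theta> * \<phi> \<theta>) \<partial>circle_measure)"
    by (rule integral_norm_bound)
  also have "\<dots> \<le> (\<integral>\<theta>. w \<delta> \<theta> \<partial>circle_measure)"
    by (intro integral_mono_AE integrable_norm int w_int le \<delta>)
  also have "\<dots> = K * (\<delta> * (\<integral>\<theta>. f \<theta> \<partial>circle_measure)
        + \<delta> powr (1 - \<alpha>) * (\<integral>\<theta>. cmod (v \<theta>) powr \<alpha> * f \<theta> \<partial>circle_measure))"
    unfolding w_def using spectral_densityD(2)[OF f] L_space_power_integrable(1)[OF f v] by simp
  also have "\<dots> \<le> K * (\<delta> * (\<integral>\<theta>. f \<theta> \<partial>circle_measure) + \<delta> powr (1 - \<alpha>) * \<delta> powr \<alpha>)"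
    using K(1) I by (intro mult_left_mono add_left_mono) auto
  also have "\<delta> powr (1 - \<alpha>) * \<delta> powr \<alpha> = \<delta>"
    using \<delta> by (simp add: powr_add[symmetric])
  finally show "cmod (\<integral>\<theta>. v \<theta> * \<phi> \<theta> \<partial>circle_measure) \<le> \<delta> * (K * ((\<integral>\<theta>. f \<theta> \<partial>circle_measure) + 1))"
    by (simp add: algebra_simps)
qed

text \<open>
  By linearity and by continuity of the pairing, it suffices to test \<open>\<phi>\<close> against the exponentials.
\<close>

lemma observed_space_annihilated:
  assumes f: "spectral_density f" and \<alpha>: "1 < \<alpha>" and g: "g \<in> observed_space \<alpha> N f"
    and \<phi>: "\<phi> \<in> borel_measurable circle_measure"
    and K: "0 \<le> K" "AE \<theta> in circle_measure. cmod (\<phi> \<theta>) \<le> K * f \<theta>"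
    and zero: "\<And>j. j \<notin> {0..int N} \<Longrightarrow> (\<integral>\<theta>. cis (of_int j * \<theta>) * \<phi> \<theta> \<partial>circle_measure) = 0"
  shows "(\<integral>\<theta>. g \<theta> * \<phi> \<theta> \<partial>circle_measure) = 0"
proof -
  have \<alpha>0: "0 \<le> \<alpha>" using \<alpha> by simp
  have gL: "g \<in> L_space \<alpha> f" using g by (simp add: observed_space_def)
  define B where "B = K * ((\<integral>\<theta>. f \<theta> \<partial>circle_measure) + 1)"
  have "0 \<le> (\<integral>\<theta>. f \<theta> \<partial>circle_measure)"
    using spectral_densityD(3)[OF f] by (intro integral_nonneg_AE AE_I2) auto
  then have B: "0 \<le> B" using K(1) by (simp add: B_def)
  have span_zero: "(\<integral>\<theta>. q \<theta> * \<phi> \<theta> \<partial>circle_measure) = 0" if "q \<in> observed_span N" for q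
  proof -
    obtain J b where q: "finite J" "J \<subseteq> - {0..int N}" "q = (\<lambda>\<theta>. \<Sum>j\<in>J. b j * cis (of_int j * \<theta>))"
      using \<open>q \<in> observed_span N\<close> by (auto simp: observed_span_def)
    have "integrable circle_measure (\<lambda>\<theta>. cis (of_int j * \<theta>) * \<phi> \<theta>)" for j
    proof (rule L_space_pairing(1)[OF f \<alpha> _ \<phi> K])
      show "(\<lambda>\<theta>. cis (of_int j * \<theta>)) \<in> L_space \<alpha> f"
        by (rule bounded_in_L_space[OF f \<alpha>0, where B = 1])
           (auto intro!: continuous_on_measurable_circle continuous_intros)
    qed
    then have "(\<integral>\<theta>. q \<theta> * \<phi> \<theta> \<partial>circle_measure)
        = (\<Sum>j\<in>J. b j * (\<integral>\<theta>. cis (of_int j * \<theta>) * \<phi> \<theta> \<partial>circle_measure))"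
      by (simp add: q(3) sum_distrib_right mult.assoc)
    also have "\<dots> = 0" using q(2) by (intro sum.neutral) (auto simp: zero)
    finally show ?thesis .
  qed
  \<comment> \<open>Replace \<open>g\<close> by \<open>g - q\<close> with \<open>q\<close> in the span: the integral stays the same and becomes small.\<close>
  have small: "cmod (\<integral>\<theta>. g \<theta> * \<phi> \<theta> \<partial>circle_measure) \<le> \<delta> * B" if \<delta>: "0 < \<delta>" for \<delta>
  proof -
    have "0 < \<delta> powr \<alpha>" using \<delta> by simp
    then obtain q where q: "q \<in> observed_span N"
      "weighted_power_integral \<alpha> f (\<lambda>\<theta>. g \<theta> - q \<theta>) < ennreal (\<delta> powr \<alpha>)"
      using g unfolding observed_space_def by blast
    have qL: "q \<in> L_space \<alpha> f" by (rule observed_span_in_L_space[OF f \<alpha>0 q(1)])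
    have "(\<integral>\<theta>. g \<theta> * \<phi> \<theta> \<partial>circle_measure)
        = (\<integral>\<theta>. (g \<theta> - q \<theta>) * \<phi> \<theta> \<partial>circle_measure) + (\<integral>\<theta>. q \<theta> * \<phi> \<theta> \<partial>circle_measure)"
      using L_space_pairing(1)[OF f \<alpha> gL \<phi> K] L_space_pairing(1)[OF f \<alpha> qL \<phi> K]
      by (simp add: left_diff_distrib)
    then have "cmod (\<integral>\<theta>. g \<theta> * \<phi> \<theta> \<partial>circle_measure) = cmod (\<integral>\<theta>. (g \<theta> - q \<theta>) * \<phi> \<theta> \<partial>circle_measure)"
      by (simp add: span_zero q(1))
    also have "\<dots> \<le> \<delta> * B"
      unfolding B_def
      by (rule L_space_pairing(2)[OF f \<alpha> L_space_diff[OF f \<alpha>0 gL qL] \<phi> K \<delta> less_imp_le[OF q(2)]])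
    finally show ?thesis .
  qed
  have "cmod (\<integral>\<theta>. g \<theta> * \<phi> \<theta> \<partial>circle_measure) \<le> 0 + e" if e: "0 < e" for e
  proof -
    have "e / (B + 1) * B \<le> e" using B e by (simp add: field_simps)
    then show ?thesis using small[of "e / (B + 1)"] B e by force
  qed
  then have "cmod (\<integral>\<theta>. g \<theta> * \<phi> \<theta> \<partial>circle_measure) \<le> 0" by (rule field_le_epsilon)
  then show ?thesis by simp
qed

text \<open>
  The graph of \<open>|w|\<^sup>\<alpha>\<close> lies above its tangent plane at \<open>u\<close>: since \<open>Re (cnj u w) \<le> |u| |w|\<close>, this reduces to
  the tangent of \<open>t\<^sup>\<alpha>\<close> at \<open>t = |u|\<close>.
\<close>

lemma cmod_powr_above_tangent:
  fixes u w :: complex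
  assumes \<alpha>: "1 < \<alpha>" and u: "u \<noteq> 0"
  shows "cmod u powr \<alpha> + \<alpha> * cmod u powr (\<alpha> - 2) * Re (cnj u * (w - u)) \<le> cmod w powr \<alpha>"
proof -
  have K: "0 < cmod u" using u by simp
  have "Re (cnj u * (w - u)) = Re (cnj u * w) - (cmod u)\<^sup>2"
    unfolding cmod_power2 by (simp add: power2_eq_square algebra_simps)
  also have "\<dots> \<le> cmod u * cmod w - (cmod u)\<^sup>2"
    using complex_Re_le_cmod[of "cnj u * w"] by (simp add: norm_mult)
  also have "\<dots> = cmod u * (cmod w - cmod u)" by (simp add: power2_eq_square algebra_simps)
  finally have "\<alpha> * cmod u powr (\<alpha> - 2) * Re (cnj u * (w - u))
      \<le> \<alpha> * cmod u powr (\<alpha> - 2) * (cmod u * (cmod w - cmod u))"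
    using \<alpha> by (intro mult_left_mono) auto
  also have "\<dots> = \<alpha> * cmod u powr (\<alpha> - 1) * (cmod w - cmod u)"
    using K powr_add[of "cmod u" "\<alpha> - 2" 1] by simp
  finally show ?thesis
    using powr_above_tangent[OF \<alpha> K, of "cmod w"] by (cases "cmod w = cmod u") auto
qed

text \<open>
  The general first-order condition asks that \<open>|u|\<^sup>\<alpha>\<^sup>-\<^sup>2 cnj u f\<close> annihilate the observed space, where
  \<open>u = A - h\<close>. For a residual of constant modulus the first factor is a constant, and the condition reduces to
  one on \<open>cnj u f\<close>. Integrating the tangent inequality at \<open>u\<close> then shows sufficiency.
\<close>

lemma constant_modulus_residual_optimal:
  assumes f: "spectral_density f" and \<alpha>: "1 < \<alpha>" and A: "A \<in> L_space \<alpha> f"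
    and h: "h \<in> observed_space \<alpha> N f" and K: "0 < K"
    and mod: "AE \<theta> in circle_measure. cmod (A \<theta> - h \<theta>) = K"
    and zero: "\<And>j. j \<notin> {0..int N} \<Longrightarrow>
      (\<integral>\<theta>. cis (of_int j * \<theta>) * (cnj (A \<theta> - h \<theta>) * of_real (f \<theta>)) \<partial>circle_measure) = 0"
    and g: "g \<in> observed_space \<alpha> N f"
  shows "weighted_power_integral \<alpha> f (\<lambda>\<theta>. A \<theta> - h \<theta>) \<le> weighted_power_integral \<alpha> f (\<lambda>\<theta>. A \<theta> - g \<theta>)"
proof -
  have \<alpha>0: "0 \<le> \<alpha>" using \<alpha> by simp
  define \<phi> where "\<phi> \<theta> = cnj (A \<theta> - h \<theta>) * of_real (f \<theta>)" for \<theta>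
  have hL: "h \<in> L_space \<alpha> f" and gL: "g \<in> L_space \<alpha> f" using h g by (simp_all add: observed_space_def)
  have [measurable]: "A \<in> borel_measurable circle_measure" "h \<in> borel_measurable circle_measure"
    using A hL by (simp_all add: L_space_iff)
  note [measurable] = spectral_densityD(1)[OF f]
  have inS: "AE \<theta> in circle_measure. \<theta> \<in> {-pi..pi}"
    using AE_space[of circle_measure] by simp
  have cnj_meas: "cnj \<in> borel_measurable borel"
    by (intro borel_measurable_continuous_onI continuous_intros)
  have \<phi>m: "\<phi> \<in> borel_measurable circle_measure"
    unfolding \<phi>_def using cnj_meas by measurable
  have \<phi>K: "AE \<theta> in circle_measure. cmod (\<phi> \<theta>) \<le> K * f \<theta>"
    using mod inS
  proof eventually_elim
    case (elim \<theta>)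
    have "cmod (\<phi> \<theta>) = cmod (A \<theta> - h \<theta>) * \<bar>f \<theta>\<bar>" by (simp only: \<phi>_def norm_mult complex_mod_cnj norm_of_real)
    then show ?case using elim spectral_densityD(3)[OF f elim(2)] by simp
  qed
  have K0: "0 \<le> K" using K by simp
  have int_h: "integrable circle_measure (\<lambda>\<theta>. h \<theta> * \<phi> \<theta>)" and int_g: "integrable circle_measure (\<lambda>\<theta>. g \<theta> * \<phi> \<theta>)"
    by (rule L_space_pairing(1)[OF f \<alpha> hL \<phi>m K0 \<phi>K]) (rule L_space_pairing(1)[OF f \<alpha> gL \<phi>m K0 \<phi>K])
  have "(\<integral>\<theta>. h \<theta> * \<phi> \<theta> - g \<theta> * \<phi> \<theta> \<partial>circle_measure) = 0"
    using int_h int_g observed_space_annihilated[OF f \<alpha> h \<phi>m K0 \<phi>K] observed_space_annihilated[OF f \<alpha> g \<phi>m K0 \<phi>K]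
      zero by (simp add: \<phi>_def)
  moreover have int_hg: "integrable circle_measure (\<lambda>\<theta>. h \<theta> * \<phi> \<theta> - g \<theta> * \<phi> \<theta>)" using int_h int_g by simp
  ultimately have Re0: "(\<integral>\<theta>. Re (h \<theta> * \<phi> \<theta> - g \<theta> * \<phi> \<theta>) \<partial>circle_measure) = 0"
    by (simp only: integral_Re) simp
  have int_Re: "integrable circle_measure (\<lambda>\<theta>. Re (h \<theta> * \<phi> \<theta> - g \<theta> * \<phi> \<theta>))"
    using int_hg by (rule integrable_Re)
  have AhL: "(\<lambda>\<theta>. A \<theta> - h \<theta>) \<in> L_space \<alpha> f" and AgL: "(\<lambda>\<theta>. A \<theta> - g \<theta>) \<in> L_space \<alpha> f"
    using L_space_diff[OF f \<alpha>0 A] hL gL by auto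
  note intAh = L_space_power_integrable(1)[OF f AhL]
  note intAg = L_space_power_integrable(1)[OF f AgL]
  have "(\<integral>\<theta>. cmod (A \<theta> - h \<theta>) powr \<alpha> * f \<theta> \<partial>circle_measure)
      = (\<integral>\<theta>. cmod (A \<theta> - h \<theta>) powr \<alpha> * f \<theta>
           + \<alpha> * K powr (\<alpha> - 2) * Re (h \<theta> * \<phi> \<theta> - g \<theta> * \<phi> \<theta>) \<partial>circle_measure)"
    by (subst Bochner_Integration.integral_add[OF intAh integrable_mult_right[OF int_Re]])
       (simp only: integral_mult_right_zero Re0 mult_zero_right add_0_right)
  also have "\<dots> \<le> (\<integral>\<theta>. cmod (A \<theta> - g \<theta>) powr \<alpha> * f \<theta> \<partial>circle_measure)"
  proof (rule integral_mono_AE)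
    show "AE \<theta> in circle_measure. cmod (A \<theta> - h \<theta>) powr \<alpha> * f \<theta>
           + \<alpha> * K powr (\<alpha> - 2) * Re (h \<theta> * \<phi> \<theta> - g \<theta> * \<phi> \<theta>) \<le> cmod (A \<theta> - g \<theta>) powr \<alpha> * f \<theta>"
      using mod inS
    proof eventually_elim
      case (elim \<theta>)
      define u w where "u = A \<theta> - h \<theta>" and "w = A \<theta> - g \<theta>"
      have "u \<noteq> 0" using elim K by (auto simp: u_def)
      have "Re (h \<theta> * \<phi> \<theta> - g \<theta> * \<phi> \<theta>) = Re (of_real (f \<theta>) * (cnj u * (w - u)))"
        by (rule arg_cong[of _ _ Re]) (simp add: \<phi>_def u_def w_def algebra_simps)
      also have "\<dots> = f \<theta> * Re (cnj u * (w - u))" by simp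
      finally have eq: "Re (h \<theta> * \<phi> \<theta> - g \<theta> * \<phi> \<theta>) = f \<theta> * Re (cnj u * (w - u))" .
      have "(cmod u powr \<alpha> + \<alpha> * cmod u powr (\<alpha> - 2) * Re (cnj u * (w - u))) * f \<theta> \<le> cmod w powr \<alpha> * f \<theta>"
        using spectral_densityD(3)[OF f elim(2)]
        by (intro mult_right_mono cmod_powr_above_tangent \<alpha> \<open>u \<noteq> 0\<close>)
      then show ?case
        unfolding eq using elim(1) unfolding u_def[symmetric] w_def[symmetric] by (simp add: algebra_simps)
    qed
  qed (intro Bochner_Integration.integrable_add intAh integrable_mult_right int_Re intAg)+
  finally show ?thesis
    unfolding L_space_power_integrable(2)[OF f AhL, symmetric] L_space_power_integrable(2)[OF f AgL, symmetric]
    by (rule ennreal_leI)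
qed

section \<open>The saddle point\<close>

lemma measurable_csigned_power [measurable]:
  assumes "g \<in> borel_measurable M"
  shows "(\<lambda>x. csigned_power (g x) \<beta>) \<in> borel_measurable M"
proof -
  have cnj: "cnj \<in> borel_measurable borel"
    by (intro borel_measurable_continuous_onI continuous_intros)
  have [measurable]: "(\<lambda>x. cnj (g x)) \<in> borel_measurable M"
    by (rule measurable_compose[OF assms cnj])
  note [measurable] = assms
  show ?thesis unfolding csigned_power_def by measurable
qed

text \<open>
  A density proportional to \<open>|p|\<close> cancels the modulus of \<open>p\<close> in the interpolation formula, so that only its
  phase survives the signed power.
\<close>

lemma csigned_power_normalized:
  assumes "0 < C" "p \<noteq> 0"
  shows "csigned_power (complex_of_real (inverse (C * cmod p)) * p) \<beta>
       = complex_of_real ((1 / C) powr \<beta> / cmod p) * cnj p"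
proof -
  have "cmod (complex_of_real (inverse (C * cmod p)) * p) = 1 / C"
    using assms by (simp only: norm_mult norm_of_real) (simp add: field_simps)
  moreover have "(1 / C) powr (\<beta> - 1) * inverse (C * cmod p) = (1 / C) powr \<beta> / cmod p"
    using assms by (simp add: powr_diff powr_minus field_simps)
  ultimately show ?thesis
    unfolding csigned_power_def
    by (simp add: mult.assoc[symmetric] of_real_mult[symmetric] del: of_real_mult of_real_inverse of_real_divide)
qed

text \<open>
  The phase \<open>cnj p / |p|\<close> may be discontinuous at the zeros of \<open>p\<close>. The regularized phases
  \<open>cnj p / (|p| + 1 / (n + 1))\<close> are continuous functions on the unit circle, bounded by \<open>1\<close>, and converge to it
  wherever \<open>p\<close> does not vanish; approximating them uniformly by trigonometric polynomials gives the bounded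
  sequence that the membership criterion asks for.
\<close>

lemma phase_characteristic_in_observed_space:
  fixes K :: real and c :: "nat \<Rightarrow> complex"
  assumes p: "p = (\<lambda>\<theta>. \<Sum>j=0..N. c j * cis (- real j * \<theta>))"
    and f: "spectral_density f" and \<alpha>: "0 < \<alpha>"
    and h: "h \<in> borel_measurable circle_measure"
    and eq: "AE \<theta> in circle_measure. p \<theta> \<noteq> 0
       \<and> functional_symbol N a \<theta> - h \<theta> = of_real (K / cmod (p \<theta>)) * cnj (p \<theta>)"
    and zero: "\<And>k. k \<le> N \<Longrightarrow> fourier_coefficient h k = 0"
  shows "h \<in> observed_space \<alpha> N f"
proof -
  define A where "A z = (\<Sum>j=0..N. a j * z ^ j)" for z :: complex
  define Q where "Q z = (\<Sum>j=0..N. c j * cnj z ^ j)" for z :: complex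
  define g where "g n z = A z - of_real (K / (cmod (Q z) + 1 / Suc n)) * cnj (Q z)" for n :: nat and z
  have A_cis: "A (cis \<theta>) = functional_symbol N a \<theta>" for \<theta>
    by (simp add: A_def functional_symbol_def Complex.DeMoivre)
  have Q_cis: "Q (cis \<theta>) = p \<theta>" for \<theta>
    by (simp add: Q_def p cis_cnj Complex.DeMoivre)
  have pos: "0 < cmod z + 1 / Suc n" for z :: complex and n
    by (intro add_nonneg_pos) auto
  have "continuous_on (sphere 0 1) (g n)" for n
    unfolding g_def A_def Q_def
    by (intro continuous_intros) (use pos in \<open>auto simp: less_imp_neq[symmetric]\<close>)
  then have "\<exists>q\<in>trigonometric_polynomials. \<forall>\<theta>. cmod (g n (cis \<theta>) - q \<theta>) < 1 / Suc n" for n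
    by (rule trigonometric_approximation[where e = "1 / Suc n"]) auto
  then obtain q where q: "\<And>n. q n \<in> trigonometric_polynomials"
    "\<And>n \<theta>. cmod (g n (cis \<theta>) - q n \<theta>) < 1 / Suc n"
    by metis
  show ?thesis
  proof (rule bounded_limit_in_observed_space[OF f \<alpha> h q(1) _ _ zero])
    fix n \<theta>
    have "cmod (A (cis \<theta>)) \<le> (\<Sum>j=0..N. cmod (a j))"
      unfolding A_def by (rule sum_norm_le) (simp add: norm_mult norm_power)
    moreover have "cmod (of_real (K / (cmod (p \<theta>) + 1 / Suc n)) * cnj (p \<theta>)) \<le> \<bar>K\<bar>"
    proof -
      have "cmod (of_real (K / (cmod (p \<theta>) + 1 / Suc n)) * cnj (p \<theta>))
          = \<bar>K\<bar> * (cmod (p \<theta>) / (cmod (p \<theta>) + 1 / Suc n))"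
        using pos[of "p \<theta>" n] by (simp only: norm_mult norm_of_real abs_divide complex_mod_cnj) simp
      also have "\<dots> \<le> \<bar>K\<bar> * 1"
        using pos[of "p \<theta>" n] by (intro mult_left_mono) (auto simp: divide_le_eq_1)
      finally show ?thesis by simp
    qed
    ultimately have "cmod (g n (cis \<theta>)) \<le> (\<Sum>j=0..N. cmod (a j)) + \<bar>K\<bar>"
      unfolding g_def Q_cis using norm_triangle_ineq4[of "A (cis \<theta>)"] by (meson add_mono order_trans)
    moreover have "cmod (g n (cis \<theta>) - q n \<theta>) \<le> 1"
      using q(2)[of n \<theta>] by (rule less_imp_le[OF less_le_trans]) (simp add: field_simps)
    moreover have "cmod (q n \<theta>) \<le> cmod (g n (cis \<theta>)) + cmod (g n (cis \<theta>) - q n \<theta>)"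
      using norm_triangle_ineq4[of "g n (cis \<theta>)" "g n (cis \<theta>) - q n \<theta>"] by simp
    ultimately show "cmod (q n \<theta>) \<le> (\<Sum>j=0..N. cmod (a j)) + \<bar>K\<bar> + 1" by linarith
  next
    show "AE \<theta> in circle_measure. (\<lambda>n. q n \<theta>) \<longlonglongrightarrow> h \<theta>"
      using eq
    proof eventually_elim
      case (elim \<theta>)
      have inv: "(\<lambda>n. 1 / real (Suc n)) \<longlonglongrightarrow> 0"
        using LIMSEQ_inverse_real_of_nat by (simp add: inverse_eq_divide)
      have "(\<lambda>n. g n (cis \<theta>)) \<longlonglongrightarrow> A (cis \<theta>) - of_real (K / (cmod (p \<theta>) + 0)) * cnj (p \<theta>)"
        unfolding g_def Q_cis using elim
        by (intro tendsto_intros inv) auto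
      moreover have "(\<lambda>n. g n (cis \<theta>) - q n \<theta>) \<longlonglongrightarrow> 0"
        by (rule Lim_null_comparison[OF always_eventually inv]) (use q(2) in \<open>auto intro: less_imp_le\<close>)
      ultimately have "(\<lambda>n. g n (cis \<theta>) - (g n (cis \<theta>) - q n \<theta>))
          \<longlonglongrightarrow> A (cis \<theta>) - of_real (K / (cmod (p \<theta>) + 0)) * cnj (p \<theta>) - 0"
        by (rule tendsto_diff)
      moreover have "h \<theta> = A (cis \<theta>) - of_real (K / cmod (p \<theta>)) * cnj (p \<theta>)"
        using elim by (simp add: A_cis algebra_simps)
      ultimately show ?case by simp
    qed
  qed
qed

lemma functional_symbol_in_L_space:
  assumes "spectral_density f" "0 \<le> \<alpha>"
  shows "functional_symbol N a \<in> L_space \<alpha> f"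
proof (rule bounded_in_L_space[OF assms, where B = "\<Sum>j=0..N. cmod (a j)"])
  show "functional_symbol N a \<in> borel_measurable circle_measure"
    unfolding functional_symbol_def[abs_def] by (intro continuous_on_measurable_circle continuous_intros)
  show "cmod (functional_symbol N a \<theta>) \<le> (\<Sum>j=0..N. cmod (a j))" for \<theta>
    unfolding functional_symbol_def by (rule sum_norm_le) (simp add: norm_mult)
qed

lemma optimal_characteristic_is_arg_min:
  assumes "spectral_density f" "1 < \<alpha>"
  shows "is_arg_min (\<lambda>h. estimation_error \<alpha> N a h f) (\<lambda>h. h \<in> observed_space \<alpha> N f)
           (optimal_characteristic \<alpha> N a f)"
proof -
  have "0 \<le> \<alpha>" using assms(2) by simp
  obtain h where "is_arg_min (\<lambda>h. estimation_error \<alpha> N a h f) (\<lambda>h. h \<in> observed_space \<alpha> N f) h"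
    unfolding estimation_error_def
    by (rule observed_space_minimizer_exists[OF assms functional_symbol_in_L_space[OF assms(1) \<open>0 \<le> \<alpha>\<close>]])
  then show ?thesis
    unfolding optimal_characteristic_def arg_min_def
    by (rule someI[of "is_arg_min (\<lambda>h. estimation_error \<alpha> N a h f) (\<lambda>h. h \<in> observed_space \<alpha> N f)"])
qed

lemma optimal_error_le:
  assumes "spectral_density f" "1 < \<alpha>" "h \<in> observed_space \<alpha> N f"
  shows "optimal_error \<alpha> N a f \<le> estimation_error \<alpha> N a h f"
  using optimal_characteristic_is_arg_min[OF assms(1,2), of N a] assms(3)
  by (auto simp: optimal_error_def is_arg_min_def not_less)

text \<open>
  The reason for the saddle point: a residual of constant modulus makes the same error under every density
  of the same total power.
\<close>

lemma constant_modulus_error: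
  assumes f: "f \<in> fixed_power_class P" and K: "0 \<le> K"
    and mod: "AE \<theta> in circle_measure. cmod (functional_symbol N a \<theta> - h \<theta>) = K"
  shows "estimation_error \<alpha> N a h f = ennreal (K powr \<alpha> * P)"
proof -
  have f': "spectral_density f" "(\<integral>\<theta>. f \<theta> \<partial>circle_measure) = P"
    using f by (auto simp: fixed_power_class_def)
  have "estimation_error \<alpha> N a h f = (\<integral>\<^sup>+\<theta>. ennreal (K powr \<alpha> * f \<theta>) \<partial>circle_measure)"
    unfolding estimation_error_def weighted_power_integral_def
    using mod by (intro nn_integral_cong_AE) auto
  also have "\<dots> = ennreal (\<integral>\<theta>. K powr \<alpha> * f \<theta> \<partial>circle_measure)"
    using spectral_densityD(2,3)[OF f'(1)] by (intro nn_integral_eq_integral AE_I2) auto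
  finally show ?thesis using f'(2) by simp
qed

theorem theorem6:
  fixes \<alpha> P C :: real and N :: nat and a c :: "nat \<Rightarrow> complex" and f\<^sub>0 :: "real \<Rightarrow> real"
  assumes "1 < \<alpha>" and "\<alpha> \<le> 2" and "0 < P" and "0 < C"
    and "\<And>\<theta>. \<theta> \<in> {-pi..pi} \<Longrightarrow> f\<^sub>0 \<theta> = C * cmod (\<Sum>j=0..N. c j * cis (- real j * \<theta>))"
    and "minimality_condition \<alpha> f\<^sub>0"
    and "\<And>k. k \<in> {0..N} \<Longrightarrow>
           (\<integral>\<theta>. cis (- real k * \<theta>) * interpolation_characteristic \<alpha> N a c f\<^sub>0 \<theta>
              \<partial>circle_measure) = 0"
    and "f\<^sub>0 \<in> fixed_power_class P"
  shows "least_favorable \<alpha> N a (fixed_power_class P) f\<^sub>0 \<and>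
         minimax_characteristic \<alpha> N a (fixed_power_class P) (optimal_characteristic \<alpha> N a f\<^sub>0) \<and>
         (AE \<theta> in circle_measure.
            optimal_characteristic \<alpha> N a f\<^sub>0 \<theta> = interpolation_characteristic \<alpha> N a c f\<^sub>0 \<theta>)"
proof -
  note \<alpha> = assms(1) and C = assms(4) and f0_eq = assms(5) and f0_in = assms(8)
  have \<alpha>0: "0 < \<alpha>" "0 \<le> \<alpha>" using \<alpha> by auto
  define D where "D = fixed_power_class P"
  have D: "spectral_density f" if "f \<in> D" for f
    using that by (simp add: D_def fixed_power_class_def)
  have f0_D: "f\<^sub>0 \<in> D" using f0_in by (simp add: D_def)
  note f0 = D[OF f0_D]
  define \<beta> where "\<beta> = 1 / (\<alpha> - 1)"
  define K where "K = (1 / C) powr \<beta>"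
  have K: "0 < K" using C by (simp add: K_def)
  define p where "p \<theta> = (\<Sum>j=0..N. c j * cis (- real j * \<theta>))" for \<theta>
  then have p_eq: "p = (\<lambda>\<theta>. \<Sum>j=0..N. c j * cis (- real j * \<theta>))" by (rule ext)
  define h where "h = interpolation_characteristic \<alpha> N a c f\<^sub>0"
  define A where "A = functional_symbol N a"
  have AL: "A \<in> L_space \<alpha> f" if "f \<in> D" for f
    unfolding A_def by (rule functional_symbol_in_L_space[OF D[OF that] \<alpha>0(2)])
  have inS: "AE \<theta> in circle_measure. \<theta> \<in> {-pi..pi}"
    using AE_space[of circle_measure] by simp
  have pos: "AE \<theta> in circle_measure. 0 < f\<^sub>0 \<theta>"
    using assms(6) by (simp add: minimality_condition_def)
  have residual: "AE \<theta> in circle_measure. p \<theta> \<noteq> 0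
      \<and> A \<theta> - h \<theta> = of_real (K / cmod (p \<theta>)) * cnj (p \<theta>)"
    using pos inS
  proof eventually_elim
    case (elim \<theta>)
    have f0p: "f\<^sub>0 \<theta> = C * cmod (p \<theta>)" using f0_eq[OF elim(2)] by (simp add: p_def)
    then have "p \<theta> \<noteq> 0" using elim(1) by auto
    moreover have "A \<theta> - h \<theta> = csigned_power (complex_of_real (inverse (f\<^sub>0 \<theta>)) * p \<theta>) \<beta>"
      by (simp add: A_def h_def functional_symbol_def interpolation_characteristic_def p_def \<beta>_def)
    ultimately show ?case
      using csigned_power_normalized[OF C, of "p \<theta>" \<beta>] by (simp add: f0p K_def)
  qed
  have mod: "AE \<theta> in circle_measure. cmod (A \<theta> - h \<theta>) = K"
    using residual
  proof eventually_elim
    case (elim \<theta>)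
    then show ?case using K by (simp only: norm_mult norm_of_real complex_mod_cnj) simp
  qed
  have pm [measurable]: "p \<in> borel_measurable circle_measure"
    unfolding p_def[abs_def] by (intro continuous_on_measurable_circle continuous_intros)
  have Am [measurable]: "A \<in> borel_measurable circle_measure"
    using AL[OF f0_D] by (simp add: L_space_iff)
  note [measurable] = spectral_densityD(1)[OF f0]
  have hm [measurable]: "h \<in> borel_measurable circle_measure"
  proof -
    have "h = (\<lambda>\<theta>. A \<theta> - csigned_power (complex_of_real (inverse (f\<^sub>0 \<theta>)) * p \<theta>) \<beta>)"
      by (simp add: fun_eq_iff A_def h_def functional_symbol_def interpolation_characteristic_def p_def \<beta>_def)
    then show ?thesis by simp
  qed
  have h_in: "h \<in> observed_space \<alpha> N f" if "f \<in> D" for f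
  proof (rule phase_characteristic_in_observed_space[OF p_eq D[OF that] \<alpha>0(1) hm])
    show "AE \<theta> in circle_measure. p \<theta> \<noteq> 0
       \<and> functional_symbol N a \<theta> - h \<theta> = of_real (K / cmod (p \<theta>)) * cnj (p \<theta>)"
      using residual unfolding A_def .
    show "fourier_coefficient h k = 0" if "k \<le> N" for k
      using assms(7)[of k] that by (simp add: fourier_coefficient_def h_def)
  qed
  \<comment> \<open>Multiplying the phase \<open>p / |p|\<close> by the density \<open>C |p|\<close> gives back \<open>p\<close>, whose frequencies
    \<open>0, -1, \<dots>, -N\<close> are the negatives of the unobserved ones.\<close>
  have orthogonal: "(\<integral>\<theta>. cis (of_int j * \<theta>) * (cnj (A \<theta> - h \<theta>) * of_real (f\<^sub>0 \<theta>)) \<partial>circle_measure) = 0"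
    if j: "j \<notin> {0..int N}" for j
  proof -
    have cnj: "cnj \<in> borel_measurable borel"
      by (intro borel_measurable_continuous_onI continuous_intros)
    have cis_meas [measurable]: "(\<lambda>\<theta>. cis (x * \<theta>)) \<in> borel_measurable circle_measure" for x
      by (intro continuous_on_measurable_circle continuous_intros)
    have "(\<integral>\<theta>. cis (of_int j * \<theta>) * (cnj (A \<theta> - h \<theta>) * of_real (f\<^sub>0 \<theta>)) \<partial>circle_measure)
        = (\<integral>\<theta>. (\<Sum>k=0..N. of_real (K * C) * c k * cis (of_int (j - int k) * \<theta>)) \<partial>circle_measure)"
    proof (rule integral_cong_AE)
      show "(\<lambda>\<theta>. cis (of_int j * \<theta>) * (cnj (A \<theta> - h \<theta>) * of_real (f\<^sub>0 \<theta>))) \<in> borel_measurable circle_measure"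
        using cnj by measurable
      show "(\<lambda>\<theta>. \<Sum>k=0..N. of_real (K * C) * c k * cis (of_int (j - int k) * \<theta>)) \<in> borel_measurable circle_measure"
        by measurable
      show "AE \<theta> in circle_measure. cis (of_int j * \<theta>) * (cnj (A \<theta> - h \<theta>) * of_real (f\<^sub>0 \<theta>))
          = (\<Sum>k=0..N. of_real (K * C) * c k * cis (of_int (j - int k) * \<theta>))"
        using residual inS
      proof eventually_elim
        case (elim \<theta>)
        have f0p: "f\<^sub>0 \<theta> = C * cmod (p \<theta>)" using f0_eq[OF elim(2)] by (simp add: p_def)
        have "cnj (A \<theta> - h \<theta>) * of_real (f\<^sub>0 \<theta>) = of_real (K * C) * p \<theta>"
          using elim by (simp add: f0p)
        then have "cis (of_int j * \<theta>) * (cnj (A \<theta> - h \<theta>) * of_real (f\<^sub>0 \<theta>))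
            = cis (of_int j * \<theta>) * (of_real (K * C) * p \<theta>)" by simp
        also have "\<dots> = (\<Sum>k=0..N. of_real (K * C) * c k * (cis (of_int j * \<theta>) * cis (- real k * \<theta>)))"
          by (simp add: p_def sum_distrib_left mult_ac)
        also have "\<dots> = (\<Sum>k=0..N. of_real (K * C) * c k * cis (of_int (j - int k) * \<theta>))"
          by (intro sum.cong refl) (simp add: cis_mult algebra_simps)
        finally show ?case .
      qed
    qed
    also have "\<dots> = (\<Sum>k=0..N. of_real (K * C) * c k * (\<integral>\<theta>. cis (of_int (j - int k) * \<theta>) \<partial>circle_measure))"
    proof -
      have "integrable circle_measure (\<lambda>\<theta>. cis (of_int (j - int k) * \<theta>))" for k
        by (rule bounded_integrable_circle[where B = 1, OF cis_meas]) simp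
      then show ?thesis by (simp add: Bochner_Integration.integral_sum)
    qed
    also have "\<dots> = 0"
    proof (rule sum.neutral, rule ballI)
      fix k assume "k \<in> {0..N}"
      then have "j - int k \<noteq> 0" using j by auto
      from integral_cis_circle[OF this]
      show "of_real (K * C) * c k * (\<integral>\<theta>. cis (of_int (j - int k) * \<theta>) \<partial>circle_measure) = 0"
        by (simp only: mult_zero_right)
    qed
    finally show ?thesis .
  qed
  have h_opt: "estimation_error \<alpha> N a h f\<^sub>0 \<le> estimation_error \<alpha> N a g f\<^sub>0"
    if "g \<in> observed_space \<alpha> N f\<^sub>0" for g
    using constant_modulus_residual_optimal[OF f0 \<alpha> AL[OF f0_D] h_in[OF f0_D] K mod orthogonal that]
    by (simp add: estimation_error_def A_def)
  then have h_arg_min: "is_arg_min (\<lambda>h. estimation_error \<alpha> N a h f\<^sub>0) (\<lambda>h. h \<in> observed_space \<alpha> N f\<^sub>0) h"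
    using h_in[OF f0_D] by (auto simp: is_arg_min_def not_less)
  define g where "g = optimal_characteristic \<alpha> N a f\<^sub>0"
  have g_arg_min: "is_arg_min (\<lambda>h. estimation_error \<alpha> N a h f\<^sub>0) (\<lambda>h. h \<in> observed_space \<alpha> N f\<^sub>0) g"
    unfolding g_def by (rule optimal_characteristic_is_arg_min[OF f0 \<alpha>])
  have gh: "AE \<theta> in circle_measure. g \<theta> = h \<theta>"
    using observed_space_minimizer_unique[OF f0 \<alpha> AL[OF f0_D] pos] g_arg_min h_arg_min
    by (simp add: estimation_error_def A_def)
  have gm: "g \<in> borel_measurable circle_measure"
    using g_arg_min observed_space_measurable by (auto simp: is_arg_min_def)
  have g_mod: "AE \<theta> in circle_measure. cmod (A \<theta> - g \<theta>) = K"
    using gh mod by eventually_elim simp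
  define V where "V = ennreal (K powr \<alpha> * P)"
  have err_h: "estimation_error \<alpha> N a h f = V" and err_g: "estimation_error \<alpha> N a g f = V" if "f \<in> D" for f
    using constant_modulus_error[of f P K N a] that mod g_mod K by (auto simp: V_def D_def A_def)
  have opt_f0: "optimal_error \<alpha> N a f\<^sub>0 = V"
    using err_g[OF f0_D] by (simp add: optimal_error_def g_def)
  have lower: "V \<le> estimation_error \<alpha> N a k f\<^sub>0" if "k \<in> observed_space \<alpha> N f\<^sub>0" for k
    using h_opt[OF that] err_h[OF f0_D] by simp
  have opt_le: "optimal_error \<alpha> N a f \<le> V" if "f \<in> D" for f
    using optimal_error_le[OF D[OF that] \<alpha> h_in[OF that], of a] err_h[OF that] by simp
  have "least_favorable \<alpha> N a D f\<^sub>0"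
    unfolding least_favorable_def is_arg_max_def opt_f0
    using f0_D opt_le by (auto simp: not_less)
  moreover have "minimax_characteristic \<alpha> N a D g"
    unfolding minimax_characteristic_def
  proof
    have g_in: "g \<in> observed_space \<alpha> N f" if "f \<in> D" for f
    proof (rule observed_space_closed[OF D[OF that] \<alpha>0(2) gm])
      fix e :: real assume "0 < e"
      have "AE \<theta> in circle_measure. g \<theta> - h \<theta> = 0" using gh by eventually_elim simp
      then have "weighted_power_integral \<alpha> f (\<lambda>\<theta>. g \<theta> - h \<theta>) = weighted_power_integral \<alpha> f (\<lambda>_. 0)"
        by (rule weighted_power_integral_cong_AE)
      also have "\<dots> = 0" by (simp add: weighted_power_integral_def)
      finally show "\<exists>k\<in>observed_space \<alpha> N f. weighted_power_integral \<alpha> f (\<lambda>\<theta>. g \<theta> - k \<theta>) < ennreal e"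
        using h_in[OF that] \<open>0 < e\<close> by (intro bexI[of _ h]) auto
    qed
    have "(SUP f\<in>D. estimation_error \<alpha> N a g f) = V"
    proof -
      have "D \<noteq> {}" using f0_D by blast
      then show ?thesis by (simp add: err_g cong: SUP_cong)
    qed
    moreover have "V \<le> (SUP f\<in>D. estimation_error \<alpha> N a k f)" if "k \<in> robust_space \<alpha> N D" for k
      using that f0_D by (intro SUP_upper2[OF f0_D] lower) (auto simp: robust_space_def)
    ultimately show "is_arg_min (\<lambda>h. SUP f\<in>D. estimation_error \<alpha> N a h f) (\<lambda>h. h \<in> robust_space \<alpha> N D) g"
      using g_in by (auto simp: is_arg_min_def not_less robust_space_def)
    show "\<exists>f. is_arg_max (\<lambda>f. estimation_error \<alpha> N a g f) (\<lambda>f. f \<in> D) f"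
      using f0_D err_g by (intro exI[of _ f\<^sub>0]) (auto simp: is_arg_max_def)
  qed
  ultimately show ?thesis
    using gh by (simp add: D_def g_def h_def)
qed

end
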